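(* For every ordered groupoid $\mathcal{G}$, the double functor $\kappa_{\mathcal{G}}\colon\mathbf{G}\mathbf{L}(\mathcal{G})\to\mathcal{G}$ (defined in the context) is a weak equivalence of double categories.
   Context: An ordered groupoid is a small groupoid $\mathcal{G}$ with a partial order $\le$ on its arrows, inducing one on objects via identities ($A\le B$ iff $1_A\le 1_B$), such that: $a\le b$ implies $a^{-1}\le b^{-1}$; $a\le b$ and $c\le d$ imply $ac\le bd$ when both composites are defined; and for each $f\colon A\to B$ and $A'\le A$ there is a unique arrow $f|_{A'}\colon A'\to B'$ with domain $A'$ and $f|_{A'}\le f$. It is regarded as a double category, i.e. an internal category in $\mathbf{Cat}$: $\mathcal{G}_0$ is the poset of objects (its arrows are the vertical arrows), and $\mathcal{G}_1$ is the poset of groupoid arrows (horizontal arrows; the relations $g\le g'$ are the double cells), with the evident source, target, unit and composition. Double functors are order-preserving functors. $\mathbf{L}(\mathcal{G})$ is the left-cancellative category (all arrows monic) with the objects of $\mathcal{G}$, arrows $A\to B$ the pairs consisting of a horizontal $h\colon A\to B'$ with $B'\le B$, and composition of $(h\colon A\to B'\le B)$ and $(k\colon B\to C'\le C)$ given by $(k|_{B'}\circ h\colon A\to C''\le C)$. For a left-cancellative category $\mathcal{C}$, $\mathbf{G}(\mathcal{C})$ is the ordered groupoid whose objects are subobjects $[m\colon A\to B]$ in $\mathcal{C}$ (arrows modulo precomposition with isomorphisms), whose arrows $[m]\to[n]$ are spans $[m,n]$ with common domain modulo isomorphism of the apex, with $[m]\le [m']$ iff $m=m'h$ for some $h$ and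 $[m,n]\le[m',n']$ iff $m=m'h$ and $n=n'h$ for a common $h$. Consequently $\mathbf{G}\mathbf{L}(\mathcal{G})$ is described, using canonical representatives, as follows: objects are pairs $(B',B)$ of objects of $\mathcal{G}$ with $B'\le B$; horizontal arrows $(B',B)\to(C',C)$ are horizontal arrows $h\colon B'\to C'$ of $\mathcal{G}$; $(B',B)\le(D',D)$ iff $B=D$ and $B'\le D'$; and $\bigl(h\colon(B',B)\to(C',C)\bigr)\le\bigl(k\colon(D',D)\to(E',E)\bigr)$ iff $B=D$, $C=E$ and $h\le k$ in $\mathcal{G}$. The double functor $\kappa_{\mathcal{G}}$ sends $(B',B)$ to $B'$, $h\colon (B',B)\to(C',C)$ to $h\colon B'\to C'$, and acts correspondingly on vertical arrows and double cells. A functor $F\colon\mathbb{C}\to\mathbb{D}$ of internal categories in a category $\mathcal{D}$ is a weak equivalence if (1) it is essentially surjective: the composite $\mathbb{C}_0\times_{\mathbb{D}_0}\mathbb{D}_1\xrightarrow{\pi_2}\mathbb{D}_1\xrightarrow{t}\mathbb{D}_0$ (pullback of $F_0\colon \mathbb{C}_0\to\mathbb{D}_0$ along $s\colon\mathbb{D}_1\to\mathbb{D}_0$) is an effective descent morphism in $\mathcal{D}$; and (2) it is fully faithful: the square with sides $F_1\colon\mathbb{C}_1\to\mathbb{D}_1$, $(s,t)\colon\mathbb{C}_1\to\mathbb{C}_0\times\mathbb{C}_0$, $(s,t)\colon\mathbb{D}_1\to\mathbb{D}_0\times\mathbb{D}_0$ and $F_0\times F_0$ is a pullback. A weak equivalence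 of double categories is this notion for $\mathcal{D}=\mathbf{Cat}$, the category of small categories. *)

theory Defs
  imports Main
begin

section \<open>Small categories and functors\<close>

text \<open>\<open>Cmp C g f\<close> is the composite of \<open>g\<close> after \<open>f\<close>, relevant only when \<open>Dom C g = Cod C f\<close>.
  All operations are unconstrained outside the carriers.\<close>

record ('o, 'a) cat =
  Obj :: "'o set"
  Arr :: "'a set"
  Dom :: "'a \<Rightarrow> 'o"
  Cod :: "'a \<Rightarrow> 'o"
  Ide :: "'o \<Rightarrow> 'a"
  Cmp :: "'a \<Rightarrow> 'a \<Rightarrow> 'a"

locale category =
  fixes C :: "('o, 'a, 'z) cat_scheme"
  assumes Dom_in: "f \<in> Arr C \<Longrightarrow> Dom C f \<in> Obj C"
    and Cod_in: "f \<in> Arr C \<Longrightarrow> Cod C f \<in> Obj C"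
    and Ide_in: "x \<in> Obj C \<Longrightarrow> Ide C x \<in> Arr C"
    and Dom_Ide: "x \<in> Obj C \<Longrightarrow> Dom C (Ide C x) = x"
    and Cod_Ide: "x \<in> Obj C \<Longrightarrow> Cod C (Ide C x) = x"
    and Cmp_in: "\<lbrakk>f \<in> Arr C; g \<in> Arr C; Dom C g = Cod C f\<rbrakk> \<Longrightarrow> Cmp C g f \<in> Arr C"
    and Dom_Cmp: "\<lbrakk>f \<in> Arr C; g \<in> Arr C; Dom C g = Cod C f\<rbrakk> \<Longrightarrow> Dom C (Cmp C g f) = Dom C f"
    and Cod_Cmp: "\<lbrakk>f \<in> Arr C; g \<in> Arr C; Dom C g = Cod C f\<rbrakk> \<Longrightarrow> Cod C (Cmp C g f) = Cod C g"
    and Cmp_Ide_right: "f \<in> Arr C \<Longrightarrow> Cmp C f (Ide C (Dom C f)) = f"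
    and Cmp_Ide_left: "f \<in> Arr C \<Longrightarrow> Cmp C (Ide C (Cod C f)) f = f"
    and Cmp_assoc: "\<lbrakk>f \<in> Arr C; g \<in> Arr C; h \<in> Arr C; Dom C g = Cod C f; Dom C h = Cod C g\<rbrakk>
      \<Longrightarrow> Cmp C (Cmp C h g) f = Cmp C h (Cmp C g f)"

definition inverse_arrows :: "('o, 'a, 'z) cat_scheme \<Rightarrow> 'a \<Rightarrow> 'a \<Rightarrow> bool" where
  "inverse_arrows C f g \<longleftrightarrow> f \<in> Arr C \<and> g \<in> Arr C \<and> Dom C g = Cod C f \<and> Cod C g = Dom C f \<and>
     Cmp C g f = Ide C (Dom C f) \<and> Cmp C f g = Ide C (Cod C f)"

definition iso :: "('o, 'a, 'z) cat_scheme \<Rightarrow> 'a \<Rightarrow> bool" where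
  "iso C f \<longleftrightarrow> (\<exists>g. inverse_arrows C f g)"

definition Inv :: "('o, 'a, 'z) cat_scheme \<Rightarrow> 'a \<Rightarrow> 'a" where
  "Inv C f = (THE g. inverse_arrows C f g)"

record ('o, 'a, 'p, 'b) fnct =
  OMap :: "'o \<Rightarrow> 'p"
  AMap :: "'a \<Rightarrow> 'b"

definition is_functor ::
  "('o, 'a) cat \<Rightarrow> ('p, 'b) cat \<Rightarrow> ('o, 'a, 'p, 'b) fnct \<Rightarrow> bool" where
  "is_functor A B F \<longleftrightarrow> category A \<and> category B \<and>
     (\<forall>x\<in>Obj A. OMap F x \<in> Obj B \<and> AMap F (Ide A x) = Ide B (OMap F x)) \<and>
     (\<forall>f\<in>Arr A. AMap F f \<in> Arr B \<and>
        Dom B (AMap F f) = OMap F (Dom A f) \<and> Cod B (AMap F f) = OMap F (Cod A f)) \<and>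
     (\<forall>f\<in>Arr A. \<forall>g\<in>Arr A. Dom A g = Cod A f \<longrightarrow>
        AMap F (Cmp A g f) = Cmp B (AMap F g) (AMap F f))"

text \<open>Equality of functors with domain \<open>A\<close>: the underlying HOL functions may differ outside
  the carriers of \<open>A\<close>.\<close>

definition feq ::
  "('o, 'a) cat \<Rightarrow> ('o, 'a, 'p, 'b) fnct \<Rightarrow> ('o, 'a, 'p, 'b) fnct \<Rightarrow> bool" where
  "feq A F G \<longleftrightarrow> (\<forall>x\<in>Obj A. OMap F x = OMap G x) \<and> (\<forall>f\<in>Arr A. AMap F f = AMap G f)"

definition fid :: "('o, 'a, 'o, 'a) fnct" where
  "fid = \<lparr>OMap = (\<lambda>x. x), AMap = (\<lambda>f. f)\<rparr>"

definition fcomp ::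
  "('p, 'b, 'q, 'c) fnct \<Rightarrow> ('o, 'a, 'p, 'b) fnct \<Rightarrow> ('o, 'a, 'q, 'c) fnct" (infixl "\<cdot>" 70) where
  "G \<cdot> F = \<lparr>OMap = OMap G \<circ> OMap F, AMap = AMap G \<circ> AMap F\<rparr>"

definition fpair ::
  "('o, 'a, 'p, 'b) fnct \<Rightarrow> ('o, 'a, 'q, 'c) fnct \<Rightarrow> ('o, 'a, 'p \<times> 'q, 'b \<times> 'c) fnct" where
  "fpair F G = \<lparr>OMap = (\<lambda>x. (OMap F x, OMap G x)), AMap = (\<lambda>f. (AMap F f, AMap G f))\<rparr>"

definition pr1 :: "('o \<times> 'p, 'a \<times> 'b, 'o, 'a) fnct" where
  "pr1 = \<lparr>OMap = fst, AMap = fst\<rparr>"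

definition pr2 :: "('o \<times> 'p, 'a \<times> 'b, 'p, 'b) fnct" where
  "pr2 = \<lparr>OMap = snd, AMap = snd\<rparr>"

definition prod_cat :: "('o, 'a) cat \<Rightarrow> ('p, 'b) cat \<Rightarrow> ('o \<times> 'p, 'a \<times> 'b) cat" where
  "prod_cat A B = \<lparr>
     Obj = Obj A \<times> Obj B,
     Arr = Arr A \<times> Arr B,
     Dom = (\<lambda>(f, g). (Dom A f, Dom B g)),
     Cod = (\<lambda>(f, g). (Cod A f, Cod B g)),
     Ide = (\<lambda>(x, y). (Ide A x, Ide B y)),
     Cmp = (\<lambda>(f', g') (f, g). (Cmp A f' f, Cmp B g' g))\<rparr>"

text \<open>The chosen pullback of \<open>F\<close> (with domain \<open>A\<close>) and \<open>G\<close> (with domain \<open>B\<close>).\<close>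

definition pb ::
  "('o, 'a) cat \<Rightarrow> ('o, 'a, 'q, 'c) fnct \<Rightarrow> ('p, 'b, 'q, 'c) fnct \<Rightarrow> ('p, 'b) cat
   \<Rightarrow> ('o \<times> 'p, 'a \<times> 'b) cat" where
  "pb A F G B = (prod_cat A B) \<lparr>
     Obj := {(x, y). x \<in> Obj A \<and> y \<in> Obj B \<and> OMap F x = OMap G y},
     Arr := {(f, g). f \<in> Arr A \<and> g \<in> Arr B \<and> AMap F f = AMap G g}\<rparr>"

text \<open>Universal properties and descent below are tested on the small categories whose objects and
  arrows are drawn from a type \<open>'u\<close>, which plays the role of a universe of small sets. It is an
  explicit parameter; a theorem with \<open>'u\<close> left as a type variable holds for every choice of it.

  \<open>is_pullback U P A B S P1 P2 F G\<close>: the square with \<open>P1 : P \<rightarrow> A\<close>, \<open>P2 : P \<rightarrow> B\<close>,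
  \<open>F : A \<rightarrow> S\<close>, \<open>G : B \<rightarrow> S\<close> is a pullback of categories.\<close>

definition is_pullback ::
  "'u itself \<Rightarrow> ('r, 'd) cat \<Rightarrow> ('o, 'a) cat \<Rightarrow> ('p, 'b) cat \<Rightarrow> ('q, 'c) cat
   \<Rightarrow> ('r, 'd, 'o, 'a) fnct \<Rightarrow> ('r, 'd, 'p, 'b) fnct
   \<Rightarrow> ('o, 'a, 'q, 'c) fnct \<Rightarrow> ('p, 'b, 'q, 'c) fnct \<Rightarrow> bool" where
  "is_pullback U P A B S P1 P2 F G \<longleftrightarrow>
     is_functor P A P1 \<and> is_functor P B P2 \<and> is_functor A S F \<and> is_functor B S G \<and>
     feq P (F \<cdot> P1) (G \<cdot> P2) \<and>
     (\<forall>(T :: ('u, 'u) cat) Q1 Q2.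
        is_functor T A Q1 \<and> is_functor T B Q2 \<and> feq T (F \<cdot> Q1) (G \<cdot> Q2) \<longrightarrow>
        (\<exists>H. is_functor T P H \<and> feq T (P1 \<cdot> H) Q1 \<and> feq T (P2 \<cdot> H) Q2 \<and>
          (\<forall>H'. is_functor T P H' \<and> feq T (P1 \<cdot> H') Q1 \<and> feq T (P2 \<cdot> H') Q2 \<longrightarrow>
             feq T H' H)))"


section \<open>Effective descent functors\<close>

text \<open>For \<open>p : E \<rightarrow> B\<close>, the pullback functor \<open>p\<^sup>* : Cat/B \<rightarrow> Cat/E\<close> has the left adjoint
  \<open>p\<^sub>!\<close> given by composition with \<open>p\<close>. The monad \<open>p\<^sup>* p\<^sub>!\<close> sends \<open>\<gamma> : C \<rightarrow> E\<close> to
  \<open>\<pi>\<^sub>1 : E \<times>\<^sub>B C \<rightarrow> E\<close>; its unit is \<open>c \<mapsto> (\<gamma> c, c)\<close> and its multiplication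
  \<open>(e, (e', c)) \<mapsto> (e, c)\<close>. The functor \<open>p\<close> is an effective descent morphism iff \<open>p\<^sup>*\<close> is monadic,
  that is, iff the comparison functor from \<open>Cat/B\<close> to the category of algebras of this monad
  (the category of descent data) is an equivalence.\<close>

definition descent_datum ::
  "('o, 'a) cat \<Rightarrow> ('p, 'b) cat \<Rightarrow> ('o, 'a, 'p, 'b) fnct
   \<Rightarrow> ('r, 'd) cat \<Rightarrow> ('r, 'd, 'o, 'a) fnct \<Rightarrow> ('o \<times> 'r, 'a \<times> 'd, 'r, 'd) fnct \<Rightarrow> bool" where
  "descent_datum E B p C \<gamma> \<xi> \<longleftrightarrow>
     is_functor C E \<gamma> \<and> is_functor (pb E p (p \<cdot> \<gamma>) C) C \<xi> \<and>
     feq (pb E p (p \<cdot> \<gamma>) C) (\<gamma> \<cdot> \<xi>) pr1 \<and>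
     feq C (\<xi> \<cdot> fpair \<gamma> fid) fid \<and>
     feq (pb E p (p \<cdot> pr1) (pb E p (p \<cdot> \<gamma>) C))
       (\<xi> \<cdot> fpair pr1 (\<xi> \<cdot> pr2)) (\<xi> \<cdot> fpair pr1 (pr2 \<cdot> pr2))"

definition descent_morphism ::
  "('o, 'a) cat \<Rightarrow> ('p, 'b) cat \<Rightarrow> ('o, 'a, 'p, 'b) fnct
   \<Rightarrow> ('r, 'd) cat \<Rightarrow> ('r, 'd, 'o, 'a) fnct \<Rightarrow> ('o \<times> 'r, 'a \<times> 'd, 'r, 'd) fnct
   \<Rightarrow> ('s, 'e) cat \<Rightarrow> ('s, 'e, 'o, 'a) fnct \<Rightarrow> ('o \<times> 's, 'a \<times> 'e, 's, 'e) fnct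
   \<Rightarrow> ('r, 'd, 's, 'e) fnct \<Rightarrow> bool" where
  "descent_morphism E B p C \<gamma> \<xi> C' \<gamma>' \<xi>' F \<longleftrightarrow>
     is_functor C C' F \<and> feq C (\<gamma>' \<cdot> F) \<gamma> \<and>
     feq (pb E p (p \<cdot> \<gamma>) C) (F \<cdot> \<xi>) (\<xi>' \<cdot> fpair pr1 (F \<cdot> pr2))"

definition descent_isomorphism ::
  "('o, 'a) cat \<Rightarrow> ('p, 'b) cat \<Rightarrow> ('o, 'a, 'p, 'b) fnct
   \<Rightarrow> ('r, 'd) cat \<Rightarrow> ('r, 'd, 'o, 'a) fnct \<Rightarrow> ('o \<times> 'r, 'a \<times> 'd, 'r, 'd) fnct
   \<Rightarrow> ('s, 'e) cat \<Rightarrow> ('s, 'e, 'o, 'a) fnct \<Rightarrow> ('o \<times> 's, 'a \<times> 'e, 's, 'e) fnct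
   \<Rightarrow> ('r, 'd, 's, 'e) fnct \<Rightarrow> bool" where
  "descent_isomorphism E B p C \<gamma> \<xi> C' \<gamma>' \<xi>' F \<longleftrightarrow>
     descent_morphism E B p C \<gamma> \<xi> C' \<gamma>' \<xi>' F \<and>
     (\<exists>F'. descent_morphism E B p C' \<gamma>' \<xi>' C \<gamma> \<xi> F' \<and> feq C (F' \<cdot> F) fid \<and> feq C' (F \<cdot> F') fid)"

text \<open>The comparison functor sends \<open>\<delta> : X \<rightarrow> B\<close> to \<open>\<pi>\<^sub>1 : E \<times>\<^sub>B X \<rightarrow> E\<close> with the structure
  \<open>(e, (e', x)) \<mapsto> (e, x)\<close>, and \<open>F : X \<rightarrow> Y\<close> over \<open>B\<close> to \<open>(e, x) \<mapsto> (e, F x)\<close>. The three conjuncts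
  about it say that it is faithful, full and essentially surjective.\<close>

abbreviation cmp_str ::
  "('o \<times> ('o \<times> 'r), 'a \<times> ('a \<times> 'd), 'o \<times> 'r, 'a \<times> 'd) fnct" where
  "cmp_str \<equiv> fpair pr1 (pr2 \<cdot> pr2)"

abbreviation cmp_map ::
  "('r, 'd, 's, 'e) fnct \<Rightarrow> ('o \<times> 'r, 'a \<times> 'd, 'o \<times> 's, 'a \<times> 'e) fnct" where
  "cmp_map F \<equiv> fpair pr1 (F \<cdot> pr2)"

definition slice_morphism ::
  "('r, 'd) cat \<Rightarrow> ('r, 'd, 'p, 'b) fnct \<Rightarrow> ('s, 'e) cat \<Rightarrow> ('s, 'e, 'p, 'b) fnct
   \<Rightarrow> ('r, 'd, 's, 'e) fnct \<Rightarrow> bool" where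
  "slice_morphism X \<delta> Y \<epsilon> F \<longleftrightarrow> is_functor X Y F \<and> feq X (\<epsilon> \<cdot> F) \<delta>"

definition effective_descent ::
  "'u itself \<Rightarrow> ('o, 'a) cat \<Rightarrow> ('p, 'b) cat \<Rightarrow> ('o, 'a, 'p, 'b) fnct \<Rightarrow> bool" where
  "effective_descent U E B p \<longleftrightarrow> is_functor E B p \<and>
     (\<forall>(X :: ('u, 'u) cat) \<delta> (Y :: ('u, 'u) cat) \<epsilon>. is_functor X B \<delta> \<and> is_functor Y B \<epsilon> \<longrightarrow>
        (\<forall>F F'. slice_morphism X \<delta> Y \<epsilon> F \<and> slice_morphism X \<delta> Y \<epsilon> F' \<and>
           feq (pb E p \<delta> X) (cmp_map F) (cmp_map F') \<longrightarrow> feq X F F') \<and>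
        (\<forall>H. descent_morphism E B p (pb E p \<delta> X) pr1 cmp_str (pb E p \<epsilon> Y) pr1 cmp_str H \<longrightarrow>
           (\<exists>F. slice_morphism X \<delta> Y \<epsilon> F \<and> feq (pb E p \<delta> X) H (cmp_map F)))) \<and>
     (\<forall>(C :: ('u, 'u) cat) \<gamma> \<xi>. descent_datum E B p C \<gamma> \<xi> \<longrightarrow>
        (\<exists>(X :: ('u, 'u) cat) \<delta> H. is_functor X B \<delta> \<and>
           descent_isomorphism E B p (pb E p \<delta> X) pr1 cmp_str C \<gamma> \<xi> H))"


section \<open>Double categories and weak equivalences\<close>

text \<open>An internal category in the category of small categories. Composable pairs are written in
  diagrammatic order: \<open>Mul\<close> sends \<open>(f, g)\<close> with \<open>Tgt f = Src g\<close> to \<open>g\<close> after \<open>f\<close>.\<close>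

record ('o, 'a, 'p, 'b) double_cat =
  Cat0 :: "('o, 'a) cat"
  Cat1 :: "('p, 'b) cat"
  Src :: "('p, 'b, 'o, 'a) fnct"
  Tgt :: "('p, 'b, 'o, 'a) fnct"
  Unt :: "('o, 'a, 'p, 'b) fnct"
  Mul :: "('p \<times> 'p, 'b \<times> 'b, 'p, 'b) fnct"

definition composables ::
  "('o, 'a, 'p, 'b) double_cat \<Rightarrow> ('p \<times> 'p, 'b \<times> 'b) cat" where
  "composables D = pb (Cat1 D) (Tgt D) (Src D) (Cat1 D)"

definition is_double_category :: "('o, 'a, 'p, 'b) double_cat \<Rightarrow> bool" where
  "is_double_category D \<longleftrightarrow>
     is_functor (Cat1 D) (Cat0 D) (Src D) \<and> is_functor (Cat1 D) (Cat0 D) (Tgt D) \<and>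
     is_functor (Cat0 D) (Cat1 D) (Unt D) \<and> is_functor (composables D) (Cat1 D) (Mul D) \<and>
     feq (Cat0 D) (Src D \<cdot> Unt D) fid \<and> feq (Cat0 D) (Tgt D \<cdot> Unt D) fid \<and>
     feq (composables D) (Src D \<cdot> Mul D) (Src D \<cdot> pr1) \<and>
     feq (composables D) (Tgt D \<cdot> Mul D) (Tgt D \<cdot> pr2) \<and>
     feq (Cat1 D) (Mul D \<cdot> fpair (Unt D \<cdot> Src D) fid) fid \<and>
     feq (Cat1 D) (Mul D \<cdot> fpair fid (Unt D \<cdot> Tgt D)) fid \<and>
     feq (pb (composables D) (Tgt D \<cdot> pr2) (Src D) (Cat1 D))
       (Mul D \<cdot> fpair (Mul D \<cdot> pr1) pr2)
       (Mul D \<cdot> fpair (pr1 \<cdot> pr1) (Mul D \<cdot> fpair (pr2 \<cdot> pr1) pr2))"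

record ('o, 'a, 'p, 'b, 'o', 'a', 'p', 'b') double_fnct =
  Fun0 :: "('o, 'a, 'o', 'a') fnct"
  Fun1 :: "('p, 'b, 'p', 'b') fnct"

definition is_double_functor ::
  "('o, 'a, 'p, 'b) double_cat \<Rightarrow> ('o', 'a', 'p', 'b') double_cat
   \<Rightarrow> ('o, 'a, 'p, 'b, 'o', 'a', 'p', 'b') double_fnct \<Rightarrow> bool" where
  "is_double_functor C D F \<longleftrightarrow> is_double_category C \<and> is_double_category D \<and>
     is_functor (Cat0 C) (Cat0 D) (Fun0 F) \<and> is_functor (Cat1 C) (Cat1 D) (Fun1 F) \<and>
     feq (Cat1 C) (Src D \<cdot> Fun1 F) (Fun0 F \<cdot> Src C) \<and>
     feq (Cat1 C) (Tgt D \<cdot> Fun1 F) (Fun0 F \<cdot> Tgt C) \<and>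
     feq (Cat0 C) (Unt D \<cdot> Fun0 F) (Fun1 F \<cdot> Unt C) \<and>
     feq (composables C) (Mul D \<cdot> fpair (Fun1 F \<cdot> pr1) (Fun1 F \<cdot> pr2)) (Fun1 F \<cdot> Mul C)"

definition ess_surjective ::
  "'u itself \<Rightarrow> ('o, 'a, 'p, 'b) double_cat \<Rightarrow> ('o', 'a', 'p', 'b') double_cat
   \<Rightarrow> ('o, 'a, 'p, 'b, 'o', 'a', 'p', 'b') double_fnct \<Rightarrow> bool" where
  "ess_surjective U C D F \<longleftrightarrow>
     effective_descent U (pb (Cat0 C) (Fun0 F) (Src D) (Cat1 D)) (Cat0 D) (Tgt D \<cdot> pr2)"

definition fully_faithful ::
  "'u itself \<Rightarrow> ('o, 'a, 'p, 'b) double_cat \<Rightarrow> ('o', 'a', 'p', 'b') double_cat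
   \<Rightarrow> ('o, 'a, 'p, 'b, 'o', 'a', 'p', 'b') double_fnct \<Rightarrow> bool" where
  "fully_faithful U C D F \<longleftrightarrow>
     is_pullback U (Cat1 C) (Cat1 D) (prod_cat (Cat0 C) (Cat0 C)) (prod_cat (Cat0 D) (Cat0 D))
       (Fun1 F) (fpair (Src C) (Tgt C))
       (fpair (Src D) (Tgt D)) (fpair (Fun0 F \<cdot> pr1) (Fun0 F \<cdot> pr2))"

definition weak_equivalence ::
  "'u itself \<Rightarrow> ('o, 'a, 'p, 'b) double_cat \<Rightarrow> ('o', 'a', 'p', 'b') double_cat
   \<Rightarrow> ('o, 'a, 'p, 'b, 'o', 'a', 'p', 'b') double_fnct \<Rightarrow> bool" where
  "weak_equivalence U C D F \<longleftrightarrow>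
     is_double_functor C D F \<and> ess_surjective U C D F \<and> fully_faithful U C D F"


section \<open>Ordered groupoids\<close>

text \<open>The order is given on arrows; the order on objects is the induced one.\<close>

record ('o, 'a) ogpd = "('o, 'a) cat" +
  Leq :: "'a \<Rightarrow> 'a \<Rightarrow> bool"

definition ObjLeq :: "('o, 'a, 'z) ogpd_scheme \<Rightarrow> 'o \<Rightarrow> 'o \<Rightarrow> bool" where
  "ObjLeq G A B \<longleftrightarrow> Leq G (Ide G A) (Ide G B)"

locale ordered_groupoid = category G
  for G :: "('o, 'a) ogpd" +
  assumes all_iso: "f \<in> Arr G \<Longrightarrow> iso G f"
    and Leq_refl: "f \<in> Arr G \<Longrightarrow> Leq G f f"
    and Leq_antisym: "\<lbrakk>f \<in> Arr G; g \<in> Arr G; Leq G f g; Leq G g f\<rbrakk> \<Longrightarrow> f = g"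
    and Leq_trans: "\<lbrakk>f \<in> Arr G; g \<in> Arr G; h \<in> Arr G; Leq G f g; Leq G g h\<rbrakk> \<Longrightarrow> Leq G f h"
    and Leq_Inv: "\<lbrakk>a \<in> Arr G; b \<in> Arr G; Leq G a b\<rbrakk> \<Longrightarrow> Leq G (Inv G a) (Inv G b)"
    and Leq_Cmp: "\<lbrakk>a \<in> Arr G; b \<in> Arr G; c \<in> Arr G; d \<in> Arr G; Leq G a b; Leq G c d;
      Dom G a = Cod G c; Dom G b = Cod G d\<rbrakk> \<Longrightarrow> Leq G (Cmp G a c) (Cmp G b d)"
    and restriction: "\<lbrakk>f \<in> Arr G; A' \<in> Obj G; ObjLeq G A' (Dom G f)\<rbrakk>
      \<Longrightarrow> \<exists>!f'. f' \<in> Arr G \<and> Dom G f' = A' \<and> Leq G f' f"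

definition restr :: "('o, 'a, 'z) ogpd_scheme \<Rightarrow> 'a \<Rightarrow> 'o \<Rightarrow> 'a" where
  "restr G f A' = (THE f'. f' \<in> Arr G \<and> Dom G f' = A' \<and> Leq G f' f)"

definition poset_cat :: "'o set \<Rightarrow> ('o \<Rightarrow> 'o \<Rightarrow> bool) \<Rightarrow> ('o, 'o \<times> 'o) cat" where
  "poset_cat S le = \<lparr>
     Obj = S,
     Arr = {(x, y). x \<in> S \<and> y \<in> S \<and> le x y},
     Dom = fst, Cod = snd,
     Ide = (\<lambda>x. (x, x)),
     Cmp = (\<lambda>g f. (fst f, snd g))\<rparr>"

definition poset_fnct :: "('o \<Rightarrow> 'p) \<Rightarrow> ('o, 'o \<times> 'o, 'p, 'p \<times> 'p) fnct" where
  "poset_fnct m = \<lparr>OMap = m, AMap = map_prod m m\<rparr>"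

text \<open>In \<open>Mul\<close> below, \<open>((f, f'), (g, g'))\<close> is a composable pair of double cells
  \<open>f \<le> f'\<close> and \<open>g \<le> g'\<close>.\<close>

definition double_of :: "('o, 'a) ogpd \<Rightarrow> ('o, 'o \<times> 'o, 'a, 'a \<times> 'a) double_cat" where
  "double_of G = \<lparr>
     Cat0 = poset_cat (Obj G) (ObjLeq G),
     Cat1 = poset_cat (Arr G) (Leq G),
     Src = poset_fnct (Dom G),
     Tgt = poset_fnct (Cod G),
     Unt = poset_fnct (Ide G),
     Mul = \<lparr>OMap = (\<lambda>(f, g). Cmp G g f),
            AMap = (\<lambda>((f, f'), (g, g')). (Cmp G g f, Cmp G g' f'))\<rparr>\<rparr>"


section \<open>The constructions L and G and the comparison kappa\<close>

text \<open>The pair \<open>(h, B)\<close> is the arrow \<open>h : A \<rightarrow> B' \<le> B\<close>.\<close>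

definition L_cat :: "('o, 'a) ogpd \<Rightarrow> ('o, 'a \<times> 'o) cat" where
  "L_cat G = \<lparr>
     Obj = Obj G,
     Arr = {(h, B). h \<in> Arr G \<and> B \<in> Obj G \<and> ObjLeq G (Cod G h) B},
     Dom = (\<lambda>(h, B). Dom G h),
     Cod = snd,
     Ide = (\<lambda>A. (Ide G A, A)),
     Cmp = (\<lambda>(k, C) (h, B). (Cmp G (restr G k (Cod G h)) h, C))\<rparr>"

text \<open>Classes \<open>[m]\<close> of arrows and \<open>[m, n]\<close> of spans, modulo precomposition with isomorphisms.
  They are meant for a left-cancellative category, in which every arrow represents a subobject.\<close>

definition subobj :: "('o, 'a) cat \<Rightarrow> 'a \<Rightarrow> 'a set" where
  "subobj C m = {Cmp C m i | i. iso C i \<and> Cod C i = Dom C m}"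

definition span :: "('o, 'a) cat \<Rightarrow> 'a \<Rightarrow> 'a \<Rightarrow> ('a \<times> 'a) set" where
  "span C m n = {(Cmp C m i, Cmp C n i) | i. iso C i \<and> Cod C i = Dom C m}"

text \<open>As classes are sets of representatives, the domain and codomain of \<open>[m, n]\<close> are its
  projections, the identity of \<open>[m]\<close>, that is \<open>[m, m]\<close>, is the diagonal of \<open>[m]\<close>, and the composite
  of \<open>[m, n]\<close> and \<open>[n, p]\<close>, that is \<open>[m, p]\<close>, is the relational composite.
  The induced order on objects is \<open>[m] \<le> [m']\<close> iff \<open>m = m' h\<close> for some \<open>h\<close>.\<close>

definition G_ogpd :: "('o, 'a) cat \<Rightarrow> ('a set, ('a \<times> 'a) set) ogpd" where
  "G_ogpd C = \<lparr>
     Obj = {subobj C m | m. m \<in> Arr C},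
     Arr = {span C m n | m n. m \<in> Arr C \<and> n \<in> Arr C \<and> Dom C m = Dom C n},
     Dom = Domain,
     Cod = Range,
     Ide = Id_on,
     Cmp = (\<lambda>Y X. X O Y),
     Leq = (\<lambda>X Y. \<exists>(m, n)\<in>X. \<exists>(m', n')\<in>Y. \<exists>h\<in>Arr C.
              Cod C h = Dom C m' \<and> m = Cmp C m' h \<and> n = Cmp C n' h)\<rparr>"

text \<open>Each object of \<open>GL(G)\<close> has a unique representative of the form \<open>1 : B' \<rightarrow> B' \<le> B\<close>; it is the
  pair \<open>(B', B)\<close>. Each arrow has a unique representative whose left leg is of this form; if its right
  leg is \<open>h : B' \<rightarrow> C' \<le> C\<close>, it is the arrow \<open>h : (B', B) \<rightarrow> (C', C)\<close>.\<close>

definition kappa_obj :: "('o, 'a) ogpd \<Rightarrow> ('a \<times> 'o) set \<Rightarrow> 'o" where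
  "kappa_obj G X = (THE B'. B' \<in> Obj G \<and> (\<exists>B. (Ide G B', B) \<in> X))"

definition kappa_arr :: "('o, 'a) ogpd \<Rightarrow> (('a \<times> 'o) \<times> ('a \<times> 'o)) set \<Rightarrow> 'a" where
  "kappa_arr G X = (THE h. h \<in> Arr G \<and> (\<exists>B C. ((Ide G (Dom G h), B), (h, C)) \<in> X))"

definition kappa where
  "kappa G = \<lparr>Fun0 = poset_fnct (kappa_obj G), Fun1 = poset_fnct (kappa_arr G)\<rparr>"

end

theory Submission
  imports Defs
begin

text \<open>A functor that lifts every composable triple of arrows is an effective descent functor
  (Janelidze, Sobral and Tholen): a descent datum identifies objects and arrows of \<open>C\<close> lying over
  the same part of the base, and the identified arrows compose because composable pairs lift, and
  compose associatively because composable triples lift. For \<open>\<kappa>\<close>, the functor to be tested goes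
  to the poset of objects of \<open>G\<close>, and chains bounded by \<open>D\<close> lift to the objects \<open>(A, D)\<close> of
  \<open>GL(G)\<close>. Full faithfulness holds because an arrow or double cell of \<open>GL(G)\<close> is its image in \<open>G\<close>
  together with its source and target.\<close>

section \<open>Functors and pullbacks of categories\<close>

text \<open>Lifts of objects and of arrows along \<open>p\<close> are chosen independently and form
  no functor: the source of \<open>lift_arr u\<close> need not be \<open>lift_obj\<close> of the
  source of \<open>u\<close>, and the chosen lifts of composable arrows need not compose. The normal
  forms built from them therefore need not form a subcategory of \<open>C\<close>: sources and
  targets have to be normalised again, and a composite has to be computed on other members of the
  two classes, found by moving the arrows with \<xi> over lifts that do compose. Every identity used
  for this comes from the two laws of the descent datum: the multiplication law says that moving
  twice is moving once, the unit law that moving to where one already is does nothing. For \<kappa>,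
  objects of \<open>GL(G)\<close> with different second components are incomparable, so a whole
  chain must be lifted with a single bound; its top object is a bound that always exists. As the
  definition of \<open>GL(G)\<close> works with classes of spans, the order and the composition are
  first computed on the normal forms, which consist of a groupoid arrow and two bounds.\<close>

lemma is_functorI:
  assumes "category A" "category B"
    and "\<And>x. x \<in> Obj A \<Longrightarrow> OMap F x \<in> Obj B"
    and "\<And>x. x \<in> Obj A \<Longrightarrow> AMap F (Ide A x) = Ide B (OMap F x)"
    and "\<And>f. f \<in> Arr A \<Longrightarrow> AMap F f \<in> Arr B"
    and "\<And>f. f \<in> Arr A \<Longrightarrow> Dom B (AMap F f) = OMap F (Dom A f)"
    and "\<And>f. f \<in> Arr A \<Longrightarrow> Cod B (AMap F f) = OMap F (Cod A f)"
    and "\<And>f g. \<lbrakk>f \<in> Arr A; g \<in> Arr A; Dom A g = Cod A f\<rbrakk>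
      \<Longrightarrow> AMap F (Cmp A g f) = Cmp B (AMap F g) (AMap F f)"
  shows "is_functor A B F"
  using assms unfolding is_functor_def by blast

lemma
  assumes "is_functor A B F"
  shows functor_source: "category A"
    and functor_target: "category B"
    and functor_Obj: "x \<in> Obj A \<Longrightarrow> OMap F x \<in> Obj B"
    and functor_Ide: "x \<in> Obj A \<Longrightarrow> AMap F (Ide A x) = Ide B (OMap F x)"
    and functor_Arr: "f \<in> Arr A \<Longrightarrow> AMap F f \<in> Arr B"
    and functor_Dom: "f \<in> Arr A \<Longrightarrow> Dom B (AMap F f) = OMap F (Dom A f)"
    and functor_Cod: "f \<in> Arr A \<Longrightarrow> Cod B (AMap F f) = OMap F (Cod A f)"
    and functor_Cmp: "\<lbrakk>f \<in> Arr A; g \<in> Arr A; Dom A g = Cod A f\<rbrakk>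
      \<Longrightarrow> AMap F (Cmp A g f) = Cmp B (AMap F g) (AMap F f)"
  using assms unfolding is_functor_def by blast+

lemma feqI:
  assumes "\<And>x. x \<in> Obj A \<Longrightarrow> OMap F x = OMap G x"
    and "\<And>f. f \<in> Arr A \<Longrightarrow> AMap F f = AMap G f"
  shows "feq A F G"
  using assms unfolding feq_def by blast

lemma
  assumes "feq A F G"
  shows feq_Obj: "x \<in> Obj A \<Longrightarrow> OMap F x = OMap G x"
    and feq_Arr: "f \<in> Arr A \<Longrightarrow> AMap F f = AMap G f"
  using assms unfolding feq_def by blast+

lemma fnct_simps [simp]:
  "OMap fid x = x" "AMap fid f = f"
  "OMap (P \<cdot> Q) x = OMap P (OMap Q x)" "AMap (P \<cdot> Q) f = AMap P (AMap Q f)"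
  "OMap (fpair P' Q') x = (OMap P' x, OMap Q' x)" "AMap (fpair P' Q') f = (AMap P' f, AMap Q' f)"
  "OMap pr1 z = fst z" "AMap pr1 w = fst w" "OMap pr2 z = snd z" "AMap pr2 w = snd w"
  by (simp_all add: fid_def fcomp_def fpair_def pr1_def pr2_def)

lemma prod_cat_simps [simp]:
  "Obj (prod_cat A B) = Obj A \<times> Obj B"
  "Arr (prod_cat A B) = Arr A \<times> Arr B"
  "Dom (prod_cat A B) f = (Dom A (fst f), Dom B (snd f))"
  "Cod (prod_cat A B) f = (Cod A (fst f), Cod B (snd f))"
  "Ide (prod_cat A B) x = (Ide A (fst x), Ide B (snd x))"
  "Cmp (prod_cat A B) g f = (Cmp A (fst g) (fst f), Cmp B (snd g) (snd f))"
  by (simp_all add: prod_cat_def split: prod.split)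

lemma pb_simps [simp]:
  "x \<in> Obj (pb A F G B) \<longleftrightarrow>
     fst x \<in> Obj A \<and> snd x \<in> Obj B \<and> OMap F (fst x) = OMap G (snd x)"
  "f \<in> Arr (pb A F G B) \<longleftrightarrow>
     fst f \<in> Arr A \<and> snd f \<in> Arr B \<and> AMap F (fst f) = AMap G (snd f)"
  "Dom (pb A F G B) f = (Dom A (fst f), Dom B (snd f))"
  "Cod (pb A F G B) f = (Cod A (fst f), Cod B (snd f))"
  "Ide (pb A F G B) x = (Ide A (fst x), Ide B (snd x))"
  "Cmp (pb A F G B) g f = (Cmp A (fst g) (fst f), Cmp B (snd g) (snd f))"
  by (auto simp: pb_def prod_cat_def split: prod.splits)

lemma functor_comp:
  assumes "is_functor A B F" "is_functor B C G"
  shows "is_functor A C (G \<cdot> F)"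
  using assms unfolding is_functor_def by simp

lemma category_prod:
  assumes "category A" "category B"
  shows "category (prod_cat A B)"
proof -
  interpret A: category A by fact
  interpret B: category B by fact
  show ?thesis
    by standard (auto simp: A.Dom_in A.Cod_in A.Ide_in A.Dom_Ide A.Cod_Ide A.Cmp_in A.Dom_Cmp
        A.Cod_Cmp A.Cmp_Ide_right A.Cmp_Ide_left A.Cmp_assoc B.Dom_in B.Cod_in B.Ide_in B.Dom_Ide
        B.Cod_Ide B.Cmp_in B.Dom_Cmp B.Cod_Cmp B.Cmp_Ide_right B.Cmp_Ide_left B.Cmp_assoc)
qed

lemma category_pb:
  assumes F: "is_functor A S F" and G: "is_functor B S G"
  shows "category (pb A F G B)"
proof -
  interpret A: category A using F by (rule functor_source)
  interpret B: category B using G by (rule functor_source)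
  show ?thesis
    by standard (auto simp: A.Dom_in A.Cod_in A.Ide_in A.Dom_Ide A.Cod_Ide A.Cmp_in A.Dom_Cmp
        A.Cod_Cmp A.Cmp_Ide_right A.Cmp_Ide_left A.Cmp_assoc B.Dom_in B.Cod_in B.Ide_in B.Dom_Ide
        B.Cod_Ide B.Cmp_in B.Dom_Cmp B.Cod_Cmp B.Cmp_Ide_right B.Cmp_Ide_left B.Cmp_assoc
        functor_Ide[OF F] functor_Ide[OF G] functor_Cmp[OF F] functor_Cmp[OF G]
        functor_Dom[OF F, symmetric] functor_Dom[OF G, symmetric]
        functor_Cod[OF F, symmetric] functor_Cod[OF G, symmetric])
qed

lemma functor_pb_pr1:
  assumes "is_functor A S F" "is_functor B S G"
  shows "is_functor (pb A F G B) A pr1"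
  using category_pb[OF assms] functor_source[OF assms(1)] by (auto simp: is_functor_def)

lemma functor_pb_pr2:
  assumes "is_functor A S F" "is_functor B S G"
  shows "is_functor (pb A F G B) B pr2"
  using category_pb[OF assms] functor_source[OF assms(2)] by (auto simp: is_functor_def)

lemma functor_fpair_prod:
  assumes "is_functor T A P" "is_functor T B Q"
  shows "is_functor T (prod_cat A B) (fpair P Q)"
  using assms category_prod[of A B] unfolding is_functor_def by auto

lemma functor_fpair_pb:
  assumes "is_functor A S F" "is_functor B S G"
    and "is_functor T A P" "is_functor T B Q" "feq T (F \<cdot> P) (G \<cdot> Q)"
  shows "is_functor T (pb A F G B) (fpair P Q)"
  using assms(3-5) category_pb[OF assms(1,2)] unfolding is_functor_def feq_def by auto

lemma functor_prod_pr1: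
  assumes "category A" "category B"
  shows "is_functor (prod_cat A B) A pr1"
  using assms category_prod[OF assms] by (auto simp: is_functor_def)

lemma functor_prod_pr2:
  assumes "category A" "category B"
  shows "is_functor (prod_cat A B) B pr2"
  using assms category_prod[OF assms] by (auto simp: is_functor_def)

text \<open>Limits of categories are computed on objects and on arrows separately, so two bijections
  suffice. The mediating functor is then forced pointwise, and its functoriality follows because the
  two projections are jointly injective. The carrier type of the test category does not
  matter.\<close>

lemma is_pullbackI:
  fixes P :: "('r, 'd) cat" and A :: "('o, 'a) cat" and B :: "('p, 'b) cat"
  assumes P1: "is_functor P A P1" and P2: "is_functor P B P2"
    and F: "is_functor A S F" and G: "is_functor B S G"
    and comm: "feq P (F \<cdot> P1) (G \<cdot> P2)"
    and obj: "\<And>a b. \<lbrakk>a \<in> Obj A; b \<in> Obj B; OMap F a = OMap G b\<rbrakk>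
      \<Longrightarrow> \<exists>!x. x \<in> Obj P \<and> OMap P1 x = a \<and> OMap P2 x = b"
    and arr: "\<And>f g. \<lbrakk>f \<in> Arr A; g \<in> Arr B; AMap F f = AMap G g\<rbrakk>
      \<Longrightarrow> \<exists>!x. x \<in> Arr P \<and> AMap P1 x = f \<and> AMap P2 x = g"
  shows "is_pullback U P A B S P1 P2 F G"
  unfolding is_pullback_def
proof (intro conjI allI impI P1 P2 F G comm; elim conjE)
  fix T :: "('u, 'u) cat" and Q1 Q2
  assume Q1: "is_functor T A Q1" and Q2: "is_functor T B Q2" and Q: "feq T (F \<cdot> Q1) (G \<cdot> Q2)"
  interpret P: category P using P1 by (rule functor_source)
  interpret T: category T using Q1 by (rule functor_source)
  note intros = functor_Obj[OF Q1] functor_Obj[OF Q2] functor_Arr[OF Q1] functor_Arr[OF Q2]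
  \<comment> \<open>Joint injectivity on objects, and below on arrows: every equation about
    \<open>H\<close> is checked by applying both projections.\<close>
  have uo: "x = y" if "x \<in> Obj P" "y \<in> Obj P" "OMap P1 x = OMap P1 y" "OMap P2 x = OMap P2 y" for x y
    using that obj[of "OMap P1 y" "OMap P2 y"] feq_Obj[OF comm] functor_Obj[OF P1] functor_Obj[OF P2]
    by (metis fnct_simps(3))
  have ua: "x = y" if "x \<in> Arr P" "y \<in> Arr P" "AMap P1 x = AMap P1 y" "AMap P2 x = AMap P2 y" for x y
    using that arr[of "AMap P1 y" "AMap P2 y"] feq_Arr[OF comm] functor_Arr[OF P1] functor_Arr[OF P2]
    by (metis fnct_simps(4))
  define H where "H = \<lparr>
    OMap = (\<lambda>t. THE x. x \<in> Obj P \<and> OMap P1 x = OMap Q1 t \<and> OMap P2 x = OMap Q2 t),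
    AMap = (\<lambda>t. THE x. x \<in> Arr P \<and> AMap P1 x = AMap Q1 t \<and> AMap P2 x = AMap Q2 t)\<rparr>"
  have "OMap H t \<in> Obj P \<and> OMap P1 (OMap H t) = OMap Q1 t \<and> OMap P2 (OMap H t) = OMap Q2 t"
    if "t \<in> Obj T" for t
    unfolding H_def fnct.simps
    by (rule theI'[OF obj]) (use that feq_Obj[OF Q that] in \<open>simp_all add: intros\<close>)
  then have Ho: "OMap H t \<in> Obj P" "OMap P1 (OMap H t) = OMap Q1 t" "OMap P2 (OMap H t) = OMap Q2 t"
    if "t \<in> Obj T" for t using that by blast+
  have "AMap H t \<in> Arr P \<and> AMap P1 (AMap H t) = AMap Q1 t \<and> AMap P2 (AMap H t) = AMap Q2 t"
    if "t \<in> Arr T" for t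
    unfolding H_def fnct.simps
    by (rule theI'[OF arr]) (use that feq_Arr[OF Q that] in \<open>simp_all add: intros\<close>)
  then have Ha: "AMap H t \<in> Arr P" "AMap P1 (AMap H t) = AMap Q1 t" "AMap P2 (AMap H t) = AMap Q2 t"
    if "t \<in> Arr T" for t using that by blast+
  note simps = T.Ide_in T.Dom_in T.Cod_in T.Cmp_in P.Ide_in P.Dom_in P.Cod_in P.Cmp_in Ho Ha
  have HD: "Dom P (AMap H f) = OMap H (Dom T f)" "Cod P (AMap H f) = OMap H (Cod T f)" if "f \<in> Arr T" for f
    using that by (auto intro!: uo simp: simps functor_Dom[OF Q1] functor_Dom[OF Q2] functor_Cod[OF Q1]
      functor_Cod[OF Q2] functor_Dom[OF P1, symmetric] functor_Dom[OF P2, symmetric]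
      functor_Cod[OF P1, symmetric] functor_Cod[OF P2, symmetric])
  have "is_functor T P H"
    by (rule is_functorI) (auto intro!: ua T.category_axioms P.category_axioms
      simp: simps HD functor_Ide[OF P1] functor_Ide[OF P2] functor_Ide[OF Q1] functor_Ide[OF Q2]
      functor_Cmp[OF P1] functor_Cmp[OF P2] functor_Cmp[OF Q1] functor_Cmp[OF Q2])
  moreover have "feq T H' H"
    if H': "is_functor T P H'" "feq T (P1 \<cdot> H') Q1" "feq T (P2 \<cdot> H') Q2" for H'
    using H'(2,3) by (auto simp: feq_def Ho Ha functor_Obj[OF H'(1)] functor_Arr[OF H'(1)] intro!: uo ua)
  moreover have "feq T (P1 \<cdot> H) Q1" "feq T (P2 \<cdot> H) Q2"
    by (auto intro: feqI simp: Ho Ha)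
  ultimately show "\<exists>H. is_functor T P H \<and> feq T (P1 \<cdot> H) Q1 \<and> feq T (P2 \<cdot> H) Q2 \<and>
      (\<forall>H'. is_functor T P H' \<and> feq T (P1 \<cdot> H') Q1 \<and> feq T (P2 \<cdot> H') Q2 \<longrightarrow> feq T H' H)"
    by blast
qed

section \<open>Functors lifting composable triples\<close>

locale triple_lifting =
  fixes E :: "('o, 'a) cat" and B :: "('p, 'b) cat" and p :: "('o, 'a, 'p, 'b) fnct"
  assumes fun_p: "is_functor E B p"
    and lift_triple: "\<lbrakk>u \<in> Arr B; v \<in> Arr B; w \<in> Arr B; Dom B v = Cod B u; Dom B w = Cod B v\<rbrakk>
      \<Longrightarrow> \<exists>u' v' w'. u' \<in> Arr E \<and> v' \<in> Arr E \<and> w' \<in> Arr E \<and> Dom E v' = Cod E u' \<and>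
        Dom E w' = Cod E v' \<and> AMap p u' = u \<and> AMap p v' = v \<and> AMap p w' = w"
begin

sublocale E: category E using fun_p by (rule functor_source)
sublocale B: category B using fun_p by (rule functor_target)

text \<open>A pair becomes a triple by adding the identity on the target of \<open>v\<close>; single
  arrows and objects are lifted by padding in the same way.\<close>

lemma lift_pair:
  assumes "u \<in> Arr B" "v \<in> Arr B" "Dom B v = Cod B u"
  shows "\<exists>u' v'. u' \<in> Arr E \<and> v' \<in> Arr E \<and> Dom E v' = Cod E u' \<and> AMap p u' = u \<and> AMap p v' = v"
  using lift_triple[OF assms(1,2) B.Ide_in[OF B.Cod_in[OF assms(2)]]] assms
  by (auto simp: B.Dom_Ide B.Cod_in)

definition lift_arr :: "'b \<Rightarrow> 'a" where
  "lift_arr u = (SOME u'. u' \<in> Arr E \<and> AMap p u' = u)"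

definition lift_obj :: "'p \<Rightarrow> 'o" where
  "lift_obj b = (SOME e. e \<in> Obj E \<and> OMap p e = b)"

lemma lift_arr: "lift_arr u \<in> Arr E" "AMap p (lift_arr u) = u" if "u \<in> Arr B" for u
proof -
  have "\<exists>u'. u' \<in> Arr E \<and> AMap p u' = u"
    using lift_pair[OF that B.Ide_in[OF B.Cod_in[OF that]]] that by (auto simp: B.Dom_Ide B.Cod_in)
  then show "lift_arr u \<in> Arr E" "AMap p (lift_arr u) = u"
    using someI_ex unfolding lift_arr_def by (smt (verit))+
qed

lemma lift_obj: "lift_obj b \<in> Obj E" "OMap p (lift_obj b) = b" if "b \<in> Obj B" for b
proof -
  have "Dom E (lift_arr (Ide B b)) \<in> Obj E" "OMap p (Dom E (lift_arr (Ide B b))) = b"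
    using that lift_arr[OF B.Ide_in[OF that]]
    by (simp_all add: E.Dom_in functor_Dom[OF fun_p, symmetric] B.Dom_Ide)
  then show "lift_obj b \<in> Obj E" "OMap p (lift_obj b) = b"
    using someI_ex unfolding lift_obj_def by (smt (verit))+
qed

text \<open>\<open>p\<close> is surjective on objects and arrows, so everything in \<open>X\<close>
  occurs as a second component in the pullback, where \<open>cmp_map F\<close> reveals the value of
  \<open>F\<close>.\<close>

lemma comparison_faithful:
  assumes "is_functor X B \<delta>" "feq (pb E p \<delta> X) (cmp_map F) (cmp_map F')"
  shows "feq X F F'"
proof (rule feqI)
  fix x assume x: "x \<in> Obj X"
  show "OMap F x = OMap F' x"
    using feq_Obj[OF assms(2), of "(lift_obj (OMap \<delta> x), x)"] x
    by (simp add: lift_obj functor_Obj[OF assms(1)])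
next
  fix f assume f: "f \<in> Arr X"
  show "AMap F f = AMap F' f"
    using feq_Arr[OF assms(2), of "(lift_arr (AMap \<delta> f), f)"] f
    by (simp add: lift_arr functor_Arr[OF assms(1)])
qed

text \<open>Compatibility of \<open>H\<close> with the algebra structures says exactly that the
  second component of \<open>H (e, x)\<close> does not depend on \<open>e\<close>. \<open>F\<close>
  is that common value, read off at a chosen lift.\<close>

lemma comparison_full:
  assumes \<delta>: "is_functor X B \<delta>" and \<epsilon>: "is_functor Y B \<epsilon>"
    and H: "descent_morphism E B p (pb E p \<delta> X) pr1 cmp_str (pb E p \<epsilon> Y) pr1 cmp_str H"
  shows "\<exists>F. slice_morphism X \<delta> Y \<epsilon> F \<and> feq (pb E p \<delta> X) H (cmp_map F)"
proof -
  interpret X: category X using \<delta> by (rule functor_source)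
  interpret Y: category Y using \<epsilon> by (rule functor_source)
  define F where "F = \<lparr>OMap = (\<lambda>x. snd (OMap H (lift_obj (OMap \<delta> x), x))),
    AMap = (\<lambda>f. snd (AMap H (lift_arr (AMap \<delta> f), f)))\<rparr>"
  have fun_H: "is_functor (pb E p \<delta> X) (pb E p \<epsilon> Y) H"
    and H1: "feq (pb E p \<delta> X) (pr1 \<cdot> H) pr1"
    and H2: "feq (pb E p (p \<cdot> pr1) (pb E p \<delta> X)) (H \<cdot> cmp_str) (cmp_str \<cdot> cmp_map H)"
    using H unfolding descent_morphism_def by blast+
  \<comment> \<open>At \<open>(e, (l, x))\<close>, with \<open>l\<close> the chosen lift, one side
    of the equation forgets \<open>l\<close> before applying \<open>H\<close> and the other side
    afterwards.\<close>
  have Ho: "OMap H (e, x) = (e, OMap F x)" if "e \<in> Obj E" "x \<in> Obj X" "OMap p e = OMap \<delta> x" for e x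
    using feq_Obj[OF H2, of "(e, (lift_obj (OMap \<delta> x), x))"] that
    by (simp add: F_def lift_obj functor_Obj[OF \<delta>])
  have Ha: "AMap H (e, f) = (e, AMap F f)" if "e \<in> Arr E" "f \<in> Arr X" "AMap p e = AMap \<delta> f" for e f
    using feq_Arr[OF H2, of "(e, (lift_arr (AMap \<delta> f), f))"] that
    by (simp add: F_def lift_arr functor_Arr[OF \<delta>])
  have obj: "OMap F x \<in> Obj Y \<and> OMap \<epsilon> (OMap F x) = OMap \<delta> x \<and>
      AMap F (Ide X x) = Ide Y (OMap F x)" if x: "x \<in> Obj X" for x
  proof -
    let ?e = "lift_obj (OMap \<delta> x)"
    have e: "?e \<in> Obj E" "OMap p ?e = OMap \<delta> x" using x by (simp_all add: lift_obj functor_Obj[OF \<delta>])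
    have ex: "(?e, x) \<in> Obj (pb E p \<delta> X)" using e x by simp
    show ?thesis
      using functor_Obj[OF fun_H ex] functor_Ide[OF fun_H ex] e x
      by (simp add: Ho Ha E.Ide_in X.Ide_in functor_Ide[OF fun_p] functor_Ide[OF \<delta>])
  qed
  have arr: "AMap F f \<in> Arr Y \<and> AMap \<epsilon> (AMap F f) = AMap \<delta> f \<and>
      Dom Y (AMap F f) = OMap F (Dom X f) \<and> Cod Y (AMap F f) = OMap F (Cod X f)"
    if f: "f \<in> Arr X" for f
  proof -
    let ?e = "lift_arr (AMap \<delta> f)"
    have e: "?e \<in> Arr E" "AMap p ?e = AMap \<delta> f" using f by (simp_all add: lift_arr functor_Arr[OF \<delta>])
    have ef: "(?e, f) \<in> Arr (pb E p \<delta> X)" using e f by simp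
    have "OMap p (Dom E ?e) = OMap \<delta> (Dom X f)" "OMap p (Cod E ?e) = OMap \<delta> (Cod X f)"
      using e f by (simp_all add: functor_Dom[OF fun_p, symmetric] functor_Dom[OF \<delta>, symmetric]
          functor_Cod[OF fun_p, symmetric] functor_Cod[OF \<delta>, symmetric])
    then show ?thesis
      using functor_Arr[OF fun_H ef] functor_Dom[OF fun_H ef] functor_Cod[OF fun_H ef] e f
      by (simp add: Ho Ha E.Dom_in X.Dom_in E.Cod_in X.Cod_in)
  qed
  have "AMap F (Cmp X g f) = Cmp Y (AMap F g) (AMap F f)"
    if fg: "f \<in> Arr X" "g \<in> Arr X" "Dom X g = Cod X f" for f g
  proof -
    \<comment> \<open>The lifts used to define \<open>F\<close> need not compose, but by
      \<open>Ha\<close> any lifts compute \<open>F\<close>, so a composable pair of lifts is used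
      instead.\<close>
    obtain u v where uv: "u \<in> Arr E" "v \<in> Arr E" "Dom E v = Cod E u" "AMap p u = AMap \<delta> f"
        "AMap p v = AMap \<delta> g"
      using lift_pair[of "AMap \<delta> f" "AMap \<delta> g"] fg
      by (auto simp: functor_Arr[OF \<delta>] functor_Dom[OF \<delta>] functor_Cod[OF \<delta>])
    show ?thesis
      using functor_Cmp[OF fun_H, of "(u, f)" "(v, g)"] uv fg
      by (simp add: Ha E.Cmp_in X.Cmp_in functor_Cmp[OF fun_p] functor_Cmp[OF \<delta>])
  qed
  then have "is_functor X Y F"
    using obj arr by (intro is_functorI X.category_axioms Y.category_axioms) auto
  moreover have "feq X (\<epsilon> \<cdot> F) \<delta>" using obj arr by (auto intro: feqI)
  moreover have "feq (pb E p \<delta> X) H (cmp_map F)" by (auto intro!: feqI simp: Ho Ha)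
  ultimately show ?thesis unfolding slice_morphism_def by blast
qed

end

section \<open>Effective descent\<close>

locale descent = triple_lifting E B p
  for E :: "('o, 'a) cat" and B :: "('p, 'b) cat" and p :: "('o, 'a, 'p, 'b) fnct" +
  fixes C :: "('r, 'd) cat" and \<gamma> :: "('r, 'd, 'o, 'a) fnct"
    and \<xi> :: "('o \<times> 'r, 'a \<times> 'd, 'r, 'd) fnct"
  assumes datum: "descent_datum E B p C \<gamma> \<xi>"
begin

section \<open>The equations of a descent datum, evaluated at objects and arrows\<close>

lemma fun_\<gamma>: "is_functor C E \<gamma>" and fun_\<xi>: "is_functor (pb E p (p \<cdot> \<gamma>) C) C \<xi>"
  using datum unfolding descent_datum_def by blast+

lemma \<gamma>_\<xi>: "feq (pb E p (p \<cdot> \<gamma>) C) (\<gamma> \<cdot> \<xi>) pr1"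
  and \<xi>_unit: "feq C (\<xi> \<cdot> fpair \<gamma> fid) fid"
  and \<xi>_mult: "feq (pb E p (p \<cdot> pr1) (pb E p (p \<cdot> \<gamma>) C))
      (\<xi> \<cdot> fpair pr1 (\<xi> \<cdot> pr2)) (\<xi> \<cdot> fpair pr1 (pr2 \<cdot> pr2))"
  using datum unfolding descent_datum_def by blast+

sublocale C: category C using fun_\<gamma> by (rule functor_source)

abbreviation po :: "'r \<Rightarrow> 'p" where "po c \<equiv> OMap p (OMap \<gamma> c)"
abbreviation pa :: "'d \<Rightarrow> 'b" where "pa f \<equiv> AMap p (AMap \<gamma> f)"

lemmas p\<gamma>_simps =
  functor_Obj[OF fun_\<gamma>] functor_Arr[OF fun_\<gamma>] functor_Obj[OF fun_p] functor_Arr[OF fun_p]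
  functor_Dom[OF fun_\<gamma>] functor_Cod[OF fun_\<gamma>] functor_Dom[OF fun_p] functor_Cod[OF fun_p]
  functor_Ide[OF fun_\<gamma>] functor_Ide[OF fun_p] functor_Cmp[OF fun_\<gamma>] functor_Cmp[OF fun_p]

lemma
  assumes "e \<in> Obj E" "c \<in> Obj C" "OMap p e = po c"
  shows \<xi>_Obj: "OMap \<xi> (e, c) \<in> Obj C"
    and \<gamma>_\<xi>_Obj: "OMap \<gamma> (OMap \<xi> (e, c)) = e"
    and \<xi>_Ide: "AMap \<xi> (Ide E e, Ide C c) = Ide C (OMap \<xi> (e, c))"
  using assms functor_Obj[OF fun_\<xi>, of "(e, c)"] feq_Obj[OF \<gamma>_\<xi>, of "(e, c)"]
    functor_Ide[OF fun_\<xi>, of "(e, c)"] by simp_all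

lemma \<xi>_Arr:
  assumes "u \<in> Arr E" "f \<in> Arr C" "AMap p u = pa f"
  shows "AMap \<xi> (u, f) \<in> Arr C"
    and "AMap \<gamma> (AMap \<xi> (u, f)) = u"
    and "Dom C (AMap \<xi> (u, f)) = OMap \<xi> (Dom E u, Dom C f)"
    and "Cod C (AMap \<xi> (u, f)) = OMap \<xi> (Cod E u, Cod C f)"
  using assms functor_Arr[OF fun_\<xi>, of "(u, f)"] feq_Arr[OF \<gamma>_\<xi>, of "(u, f)"]
    functor_Dom[OF fun_\<xi>, of "(u, f)"] functor_Cod[OF fun_\<xi>, of "(u, f)"] by simp_all

lemma \<xi>_Cmp:
  assumes "u \<in> Arr E" "f \<in> Arr C" "AMap p u = pa f" "v \<in> Arr E" "g \<in> Arr C" "AMap p v = pa g"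
    and "Dom E v = Cod E u" "Dom C g = Cod C f"
  shows "AMap \<xi> (Cmp E v u, Cmp C g f) = Cmp C (AMap \<xi> (v, g)) (AMap \<xi> (u, f))"
  using functor_Cmp[OF fun_\<xi>, of "(u, f)" "(v, g)"] assms by simp

lemma \<xi>_unit_Obj: "c \<in> Obj C \<Longrightarrow> OMap \<xi> (OMap \<gamma> c, c) = c"
  and \<xi>_unit_Arr: "f \<in> Arr C \<Longrightarrow> AMap \<xi> (AMap \<gamma> f, f) = f"
  using feq_Obj[OF \<xi>_unit, of c] feq_Arr[OF \<xi>_unit, of f] by simp_all

lemma \<xi>_mult_Obj:
  assumes "e \<in> Obj E" "e' \<in> Obj E" "c \<in> Obj C" "OMap p e' = OMap p e" "OMap p e = po c"
  shows "OMap \<xi> (e', OMap \<xi> (e, c)) = OMap \<xi> (e', c)"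
  using feq_Obj[OF \<xi>_mult, of "(e', (e, c))"] assms by simp

lemma \<xi>_mult_Arr:
  assumes "u \<in> Arr E" "u' \<in> Arr E" "f \<in> Arr C" "AMap p u' = AMap p u" "AMap p u = pa f"
  shows "AMap \<xi> (u', AMap \<xi> (u, f)) = AMap \<xi> (u', f)"
  using feq_Arr[OF \<xi>_mult, of "(u', (u, f))"] assms by simp

text \<open>Two objects or arrows of \<open>C\<close> are identified by the descent datum iff they have the same
  \<open>rep\<close>; the descended category lives on these representatives, so no new carrier type is needed.\<close>

definition rep_obj :: "'r \<Rightarrow> 'r" where
  "rep_obj c = OMap \<xi> (lift_obj (po c), c)"

definition rep_arr :: "'d \<Rightarrow> 'd" where
  "rep_arr f = AMap \<xi> (lift_arr (pa f), f)"

lemma rep_obj: "rep_obj c \<in> Obj C" "OMap \<gamma> (rep_obj c) = lift_obj (po c)" "po (rep_obj c) = po c"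
  if "c \<in> Obj C" for c
  using that by (simp_all add: rep_obj_def \<xi>_Obj \<gamma>_\<xi>_Obj lift_obj p\<gamma>_simps)

lemma rep_arr: "rep_arr f \<in> Arr C" "AMap \<gamma> (rep_arr f) = lift_arr (pa f)" "pa (rep_arr f) = pa f"
  if "f \<in> Arr C" for f
  using that by (simp_all add: rep_arr_def \<xi>_Arr lift_arr p\<gamma>_simps)

text \<open>By the multiplication law, moving to \<open>e\<close> by way of the chosen lift is the
  same as moving to \<open>e\<close> directly; hence all transports of \<open>c\<close> are
  determined by \<open>rep_obj c\<close>.\<close>

lemma \<xi>_rep_obj: "OMap \<xi> (e, rep_obj c) = OMap \<xi> (e, c)"
  if "e \<in> Obj E" "c \<in> Obj C" "OMap p e = po c"
  using that by (simp add: rep_obj_def \<xi>_mult_Obj lift_obj p\<gamma>_simps)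

lemma \<xi>_rep_arr: "AMap \<xi> (u, rep_arr f) = AMap \<xi> (u, f)"
  if "u \<in> Arr E" "f \<in> Arr C" "AMap p u = pa f"
  using that by (simp add: rep_arr_def \<xi>_mult_Arr lift_arr p\<gamma>_simps)

text \<open>The multiplication law again, now with the chosen lift as the final stop: transport
  never leaves the class.\<close>

lemma rep_obj_\<xi>: "rep_obj (OMap \<xi> (e, c)) = rep_obj c"
  if "e \<in> Obj E" "c \<in> Obj C" "OMap p e = po c"
  using that by (simp add: rep_obj_def \<gamma>_\<xi>_Obj \<xi>_mult_Obj lift_obj p\<gamma>_simps)

lemma rep_arr_\<xi>: "rep_arr (AMap \<xi> (u, f)) = rep_arr f"
  if "u \<in> Arr E" "f \<in> Arr C" "AMap p u = pa f"
  using that by (simp add: rep_arr_def \<xi>_Arr \<xi>_mult_Arr lift_arr p\<gamma>_simps)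

lemma rep_obj_rep_obj: "rep_obj (rep_obj c) = rep_obj c" if "c \<in> Obj C"
  using that rep_obj_\<xi>[of "lift_obj (po c)" c] by (simp add: rep_obj_def lift_obj p\<gamma>_simps)

lemma rep_arr_rep_arr: "rep_arr (rep_arr f) = rep_arr f" if "f \<in> Arr C"
  using that rep_arr_\<xi>[of "lift_arr (pa f)" f] by (simp add: rep_arr_def lift_arr p\<gamma>_simps)

lemma rep_obj_eqD:
  assumes "c \<in> Obj C" "c' \<in> Obj C" "rep_obj c = rep_obj c'"
  shows "po c = po c'"
    and "\<lbrakk>e \<in> Obj E; OMap p e = po c\<rbrakk> \<Longrightarrow> OMap \<xi> (e, c) = OMap \<xi> (e, c')"
proof -
  show eq: "po c = po c'" using assms rep_obj(3) by metis
  show "OMap \<xi> (e, c) = OMap \<xi> (e, c')" if "e \<in> Obj E" "OMap p e = po c"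
    using that assms eq \<xi>_rep_obj by metis
qed

lemma rep_arr_eqD:
  assumes "f \<in> Arr C" "f' \<in> Arr C" "rep_arr f = rep_arr f'"
  shows "pa f = pa f'"
    and "\<lbrakk>u \<in> Arr E; AMap p u = pa f\<rbrakk> \<Longrightarrow> AMap \<xi> (u, f) = AMap \<xi> (u, f')"
proof -
  show eq: "pa f = pa f'" using assms rep_arr(3) by metis
  show "AMap \<xi> (u, f) = AMap \<xi> (u, f')" if "u \<in> Arr E" "AMap p u = pa f"
    using that assms eq \<xi>_rep_arr by metis
qed

text \<open>The source of \<open>rep_arr f\<close> is the source of \<open>f\<close> transported to
  the source of the chosen lift of \<open>pa f\<close>. This may differ from the chosen lift of the
  source, but \<open>rep_obj\<close> does not see transport.\<close>

lemma rep_obj_Dom_rep_arr: "rep_obj (Dom C (rep_arr f)) = rep_obj (Dom C f)"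
  and rep_obj_Cod_rep_arr: "rep_obj (Cod C (rep_arr f)) = rep_obj (Cod C f)"
  if "f \<in> Arr C" for f
proof -
  have *: "lift_arr (pa f) \<in> Arr E" "AMap p (lift_arr (pa f)) = pa f"
    using that by (simp_all add: lift_arr p\<gamma>_simps)
  then have "OMap p (Dom E (lift_arr (pa f))) = po (Dom C f)"
      "OMap p (Cod E (lift_arr (pa f))) = po (Cod C f)"
    using that by (simp_all flip: functor_Dom[OF fun_p] functor_Cod[OF fun_p] add: p\<gamma>_simps)
  then show "rep_obj (Dom C (rep_arr f)) = rep_obj (Dom C f)"
      "rep_obj (Cod C (rep_arr f)) = rep_obj (Cod C f)"
    using that * by (simp_all add: rep_arr_def \<xi>_Arr rep_obj_\<xi> E.Dom_in E.Cod_in C.Dom_in C.Cod_in)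
qed

text \<open>This makes composition of classes well defined. By the unit law \<open>f'\<close> is the
  transport of \<open>f\<close> to \<open>AMap \<gamma> f'\<close>, and likewise for
  \<open>g'\<close>; since \<xi> preserves composition, the second composite is a transport of the
  first.\<close>

lemma rep_arr_Cmp:
  assumes "f \<in> Arr C" "f' \<in> Arr C" "g \<in> Arr C" "g' \<in> Arr C" "Dom C g = Cod C f" "Dom C g' = Cod C f'"
    and "rep_arr f = rep_arr f'" "rep_arr g = rep_arr g'"
  shows "rep_arr (Cmp C g f) = rep_arr (Cmp C g' f')"
proof -
  note pa = rep_arr_eqD(1)[OF assms(1,2,7)] rep_arr_eqD(1)[OF assms(3,4,8)]
  have "f' = AMap \<xi> (AMap \<gamma> f', f)" "g' = AMap \<xi> (AMap \<gamma> g', g)"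
    using rep_arr_eqD(2)[OF assms(1,2,7), of "AMap \<gamma> f'"] rep_arr_eqD(2)[OF assms(3,4,8), of "AMap \<gamma> g'"]
      assms pa by (simp_all add: p\<gamma>_simps \<xi>_unit_Arr)
  then have "Cmp C g' f' = AMap \<xi> (Cmp E (AMap \<gamma> g') (AMap \<gamma> f'), Cmp C g f)"
    using \<xi>_Cmp[of "AMap \<gamma> f'" f "AMap \<gamma> g'" g] assms pa by (simp add: p\<gamma>_simps)
  then show ?thesis
    using rep_arr_\<xi>[of "Cmp E (AMap \<gamma> g') (AMap \<gamma> f')" "Cmp C g f"] assms pa
    by (simp add: p\<gamma>_simps E.Cmp_in C.Cmp_in)
qed

text \<open>The images in \<open>B\<close> compose, so they lift to a composable triple, over which
  \<open>f\<close>, \<open>g\<close>, \<open>h\<close> are transported. Transports of equivalent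
  endpoints to one object of \<open>E\<close> coincide, so the transported arrows really compose in
  \<open>C\<close>. Pairs would not suffice for associativity, since the same \<open>g'\<close> has
  to meet both neighbours.\<close>

lemma move_triple:
  assumes "f \<in> Arr C" "g \<in> Arr C" "h \<in> Arr C"
    and fg: "rep_obj (Dom C g) = rep_obj (Cod C f)" and gh: "rep_obj (Dom C h) = rep_obj (Cod C g)"
  shows "\<exists>f' g' h'. f' \<in> Arr C \<and> g' \<in> Arr C \<and> h' \<in> Arr C \<and> Dom C g' = Cod C f' \<and> Dom C h' = Cod C g' \<and>
    rep_arr f' = rep_arr f \<and> rep_arr g' = rep_arr g \<and> rep_arr h' = rep_arr h"
proof -
  have "po (Dom C g) = po (Cod C f)" "po (Dom C h) = po (Cod C g)"
    using assms rep_obj_eqD(1) C.Dom_in C.Cod_in by metis+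
  then obtain u v w where u: "u \<in> Arr E" "AMap p u = pa f" and v: "v \<in> Arr E" "AMap p v = pa g"
      and w: "w \<in> Arr E" "AMap p w = pa h" and uvw: "Dom E v = Cod E u" "Dom E w = Cod E v"
    using lift_triple[of "pa f" "pa g" "pa h"] assms by (auto simp: p\<gamma>_simps)
  have "OMap p (Dom E v) = po (Dom C g)" "OMap p (Dom E w) = po (Dom C h)"
    using v w assms by (simp_all flip: functor_Dom[OF fun_p] add: p\<gamma>_simps)
  then have "OMap \<xi> (Dom E v, Dom C g) = OMap \<xi> (Dom E v, Cod C f)"
      "OMap \<xi> (Dom E w, Dom C h) = OMap \<xi> (Dom E w, Cod C g)"
    using rep_obj_eqD(2)[OF _ _ fg, of "Dom E v"] rep_obj_eqD(2)[OF _ _ gh, of "Dom E w"] assms v w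
    by (simp_all add: C.Dom_in C.Cod_in E.Dom_in)
  then show ?thesis
    using u v w uvw assms
    by (intro exI[of _ "AMap \<xi> (u, f)"] exI[of _ "AMap \<xi> (v, g)"] exI[of _ "AMap \<xi> (w, h)"])
      (simp add: \<xi>_Arr rep_arr_\<xi>)
qed

text \<open>This is the quotient of \<open>C\<close> by transport, the inverse of the comparison
  functor on objects. The endpoints of a normal form need not be normal forms, hence the outer
  \<open>rep_obj\<close>; composites use any composable members of the two classes, and
  \<open>rep_arr_Cmp\<close> makes the \<open>THE\<close> meaningful.\<close>

definition descended :: "('r, 'd) cat" where
  "descended = \<lparr>
     Obj = rep_obj ` Obj C,
     Arr = rep_arr ` Arr C,
     Dom = (\<lambda>f. rep_obj (Dom C f)),
     Cod = (\<lambda>f. rep_obj (Cod C f)),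
     Ide = (\<lambda>x. rep_arr (Ide C x)),
     Cmp = (\<lambda>g f. THE k. \<exists>f' g'. f' \<in> Arr C \<and> g' \<in> Arr C \<and> Dom C g' = Cod C f' \<and>
       rep_arr f' = f \<and> rep_arr g' = g \<and> k = rep_arr (Cmp C g' f'))\<rparr>"

text \<open>\<xi> preserves identities, so the identity at the representative is a transport of the
  identity at \<open>c\<close>.\<close>

lemma rep_arr_Ide: "rep_arr (Ide C (rep_obj c)) = rep_arr (Ide C c)" if "c \<in> Obj C"
  using that rep_arr_\<xi>[of "Ide E (lift_obj (po c))" "Ide C c"]
  by (simp add: rep_obj_def \<xi>_Ide[symmetric] lift_obj p\<gamma>_simps E.Ide_in C.Ide_in)

lemma descended_simps:
  "Obj descended = rep_obj ` Obj C"
  "Arr descended = rep_arr ` Arr C"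
  "c \<in> Obj C \<Longrightarrow> Ide descended (rep_obj c) = rep_arr (Ide C c)"
  "f \<in> Arr C \<Longrightarrow> Dom descended (rep_arr f) = rep_obj (Dom C f)"
  "f \<in> Arr C \<Longrightarrow> Cod descended (rep_arr f) = rep_obj (Cod C f)"
  by (simp_all add: descended_def rep_arr_Ide rep_obj_Dom_rep_arr rep_obj_Cod_rep_arr)

lemma composable_triple_in_descended:
  assumes "f \<in> Arr descended" "g \<in> Arr descended" "h \<in> Arr descended"
    and "Dom descended g = Cod descended f" "Dom descended h = Cod descended g"
  obtains f' g' h' where "f' \<in> Arr C" "g' \<in> Arr C" "h' \<in> Arr C"
    and "Dom C g' = Cod C f'" "Dom C h' = Cod C g'"
    and "f = rep_arr f'" "g = rep_arr g'" "h = rep_arr h'"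
proof -
  obtain f0 g0 h0 where 0: "f0 \<in> Arr C" "g0 \<in> Arr C" "h0 \<in> Arr C"
      "f = rep_arr f0" "g = rep_arr g0" "h = rep_arr h0"
    using assms(1-3) by (auto simp: descended_simps)
  then have "rep_obj (Dom C g0) = rep_obj (Cod C f0)" "rep_obj (Dom C h0) = rep_obj (Cod C g0)"
    using assms(4,5) by (simp_all add: descended_simps)
  from move_triple[OF 0(1-3) this] 0(4-6) that show thesis by metis
qed

lemma composable_pair_in_descended:
  assumes "f \<in> Arr descended" "g \<in> Arr descended" "Dom descended g = Cod descended f"
  obtains f' g' where "f' \<in> Arr C" "g' \<in> Arr C" "Dom C g' = Cod C f'" "f = rep_arr f'" "g = rep_arr g'"
proof -
  obtain g0 where "g0 \<in> Arr C" "g = rep_arr g0" using assms(2) by (auto simp: descended_simps)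
  then have "Ide descended (Cod descended g) \<in> Arr descended"
      "Dom descended (Ide descended (Cod descended g)) = Cod descended g"
    by (simp_all add: descended_simps C.Cod_in C.Ide_in C.Dom_Ide)
  from composable_triple_in_descended[OF assms(1,2) this(1) assms(3) this(2)] that show thesis
    by metis
qed

lemma descended_Cmp:
  assumes "f \<in> Arr C" "g \<in> Arr C" "Dom C g = Cod C f"
  shows "Cmp descended (rep_arr g) (rep_arr f) = rep_arr (Cmp C g f)"
  unfolding descended_def cat.simps
proof (rule the_equality)
  show "\<exists>f' g'. f' \<in> Arr C \<and> g' \<in> Arr C \<and> Dom C g' = Cod C f' \<and> rep_arr f' = rep_arr f \<and>
      rep_arr g' = rep_arr g \<and> rep_arr (Cmp C g f) = rep_arr (Cmp C g' f')"
    using assms by blast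
qed (use assms rep_arr_Cmp in blast)

lemma category_descended: "category descended"
proof
  fix f assume "f \<in> Arr descended"
  then obtain f' where f: "f' \<in> Arr C" "f = rep_arr f'" by (auto simp: descended_simps)
  then show "Dom descended f \<in> Obj descended" "Cod descended f \<in> Obj descended"
    by (simp_all add: descended_simps C.Dom_in C.Cod_in)
  show "Cmp descended f (Ide descended (Dom descended f)) = f"
    "Cmp descended (Ide descended (Cod descended f)) f = f"
    using f by (simp_all add: descended_simps descended_Cmp C.Dom_in C.Cod_in C.Ide_in C.Dom_Ide
        C.Cod_Ide C.Cmp_Ide_left C.Cmp_Ide_right)
next
  fix x assume "x \<in> Obj descended"
  then obtain c where c: "c \<in> Obj C" "x = rep_obj c" by (auto simp: descended_simps)
  then show "Ide descended x \<in> Arr descended" "Dom descended (Ide descended x) = x"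
      "Cod descended (Ide descended x) = x"
    by (simp_all add: descended_simps C.Ide_in C.Dom_Ide C.Cod_Ide)
next
  fix f g assume "f \<in> Arr descended" "g \<in> Arr descended" "Dom descended g = Cod descended f"
  then obtain f' g' where "f' \<in> Arr C" "g' \<in> Arr C" "Dom C g' = Cod C f'"
      "f = rep_arr f'" "g = rep_arr g'"
    by (rule composable_pair_in_descended)
  then show "Cmp descended g f \<in> Arr descended" "Dom descended (Cmp descended g f) = Dom descended f"
      "Cod descended (Cmp descended g f) = Cod descended g"
    by (simp_all add: descended_simps descended_Cmp C.Cmp_in C.Dom_Cmp C.Cod_Cmp)
next
  fix f g h assume "f \<in> Arr descended" "g \<in> Arr descended" "h \<in> Arr descended"
    "Dom descended g = Cod descended f" "Dom descended h = Cod descended g"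
  then obtain f' g' h' where "f' \<in> Arr C" "g' \<in> Arr C" "h' \<in> Arr C" "Dom C g' = Cod C f'"
      "Dom C h' = Cod C g'" "f = rep_arr f'" "g = rep_arr g'" "h = rep_arr h'"
    by (rule composable_triple_in_descended)
  then show "Cmp descended (Cmp descended h g) f = Cmp descended h (Cmp descended g f)"
    by (simp add: descended_simps descended_Cmp C.Cmp_in C.Dom_Cmp C.Cod_Cmp C.Cmp_assoc)
qed

section \<open>The quotient functor, the structure map over \<open>B\<close>, and recovery of the
  given datum\<close>

definition rep :: "('r, 'd, 'r, 'd) fnct" where
  "rep = \<lparr>OMap = rep_obj, AMap = rep_arr\<rparr>"

lemma rep_simps [simp]: "OMap rep = rep_obj" "AMap rep = rep_arr"
  by (simp_all add: rep_def)

lemma fun_rep: "is_functor C descended rep"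
  by (rule is_functorI)
    (simp_all add: C.category_axioms category_descended descended_simps descended_Cmp)

text \<open>Transport changes the position in \<open>E\<close> but not its image under
  \<open>p\<close>, so \<open>p \<cdot> \<gamma>\<close> is constant on classes and can be evaluated
  at representatives.\<close>

lemma fun_descended: "is_functor descended B (p \<cdot> \<gamma>)"
proof (rule is_functorI)
  fix f g assume "f \<in> Arr descended" "g \<in> Arr descended" "Dom descended g = Cod descended f"
  then obtain f' g' where "f' \<in> Arr C" "g' \<in> Arr C" "Dom C g' = Cod C f'"
      "f = rep_arr f'" "g = rep_arr g'"
    by (rule composable_pair_in_descended)
  then show "AMap (p \<cdot> \<gamma>) (Cmp descended g f) = Cmp B (AMap (p \<cdot> \<gamma>) g) (AMap (p \<cdot> \<gamma>) f)"
    by (simp add: descended_Cmp rep_arr(1,3) C.Cmp_in p\<gamma>_simps)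
qed (auto simp: category_descended B.category_axioms descended_simps rep_obj(1,3) rep_arr(1,3) p\<gamma>_simps
    C.Ide_in C.Dom_in C.Cod_in)

abbreviation pulled :: "('o \<times> 'r, 'a \<times> 'd) cat" where
  "pulled \<equiv> pb E p (p \<cdot> \<gamma>) descended"

text \<open>The carriers of \<open>descended\<close> lie in those of \<open>C\<close>, so \<xi> can
  be applied, but sources, targets and composites differ from those of \<open>C\<close>. The
  equations are therefore transferred from representatives to honest arrows of \<open>C\<close> by
  \<open>\<xi>_rep_obj\<close> and \<open>\<xi>_rep_arr\<close>.\<close>

lemma fun_\<xi>_descended: "is_functor pulled C \<xi>"
proof (rule is_functorI)
  show "category pulled" using fun_p fun_descended by (rule category_pb)
  show "category C" by (rule C.category_axioms)
next
  fix x assume "x \<in> Obj pulled"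
  then obtain e c where "x = (e, rep_obj c)" "e \<in> Obj E" "c \<in> Obj C" "OMap p e = po c"
    by (cases x) (auto simp: descended_simps rep_obj(1,3))
  then show "OMap \<xi> x \<in> Obj C" "AMap \<xi> (Ide pulled x) = Ide C (OMap \<xi> x)"
    by (simp_all add: \<xi>_Obj \<xi>_rep_obj \<xi>_rep_arr \<xi>_Ide descended_simps E.Ide_in C.Ide_in p\<gamma>_simps)
next
  fix f assume "f \<in> Arr pulled"
  then obtain u f' where f: "f = (u, rep_arr f')" "u \<in> Arr E" "f' \<in> Arr C" "AMap p u = pa f'"
    by (cases f) (auto simp: descended_simps rep_arr(1,3))
  then have "OMap p (Dom E u) = po (Dom C f')" "OMap p (Cod E u) = po (Cod C f')"
    by (simp_all flip: functor_Dom[OF fun_p] functor_Cod[OF fun_p] add: p\<gamma>_simps)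
  then show "AMap \<xi> f \<in> Arr C" "Dom C (AMap \<xi> f) = OMap \<xi> (Dom pulled f)"
      "Cod C (AMap \<xi> f) = OMap \<xi> (Cod pulled f)"
    using f by (simp_all add: \<xi>_Arr \<xi>_rep_arr \<xi>_rep_obj descended_simps E.Dom_in E.Cod_in C.Dom_in C.Cod_in)
next
  fix f g assume fg: "f \<in> Arr pulled" "g \<in> Arr pulled" "Dom pulled g = Cod pulled f"
  then have "snd f \<in> Arr descended" "snd g \<in> Arr descended"
      "Dom descended (snd g) = Cod descended (snd f)" by simp_all
  then obtain f' g' where f': "f' \<in> Arr C" "g' \<in> Arr C" "Dom C g' = Cod C f'"
      "snd f = rep_arr f'" "snd g = rep_arr g'"
    by (rule composable_pair_in_descended)
  obtain u v where "f = (u, rep_arr f')" "g = (v, rep_arr g')" using f' by (metis prod.collapse)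
  then show "AMap \<xi> (Cmp pulled g f) = Cmp C (AMap \<xi> g) (AMap \<xi> f)"
    using f' fg by (simp add: descended_Cmp \<xi>_rep_arr rep_arr(1,3) \<xi>_Cmp p\<gamma>_simps E.Cmp_in C.Cmp_in)
qed

text \<open>The inverse sends \<open>c\<close> to its position in \<open>E\<close> together with its
  class. One composite is the identity by the unit law; the other because transport to
  \<open>e\<close> lands over \<open>e\<close> and stays in the class.\<close>

lemma descent_isomorphism_\<xi>: "descent_isomorphism E B p pulled pr1 cmp_str C \<gamma> \<xi> \<xi>"
proof -
  let ?K = "fpair \<gamma> rep"
  have sub: "Obj descended \<subseteq> Obj C" "Arr descended \<subseteq> Arr C"
    by (auto simp: descended_simps rep_obj rep_arr)
  have rep_id: "x \<in> Obj descended \<Longrightarrow> rep_obj x = x" "f \<in> Arr descended \<Longrightarrow> rep_arr f = f" for x f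
    by (auto simp: descended_simps rep_obj_rep_obj rep_arr_rep_arr)
  have "feq pulled (\<gamma> \<cdot> \<xi>) pr1"
    using sub by (auto intro!: feqI simp: \<gamma>_\<xi>_Obj \<xi>_Arr)
  moreover have "feq (pb E p (p \<cdot> pr1) pulled) (\<xi> \<cdot> cmp_str) (\<xi> \<cdot> fpair pr1 (\<xi> \<cdot> pr2))"
    using sub by (auto intro!: feqI simp: \<xi>_mult_Obj \<xi>_mult_Arr)
  moreover have "is_functor C pulled ?K"
    by (rule functor_fpair_pb[OF fun_p fun_descended fun_\<gamma> fun_rep]) (auto intro!: feqI simp: rep_obj(1,3) rep_arr(1,3))
  moreover have "feq C (pr1 \<cdot> ?K) \<gamma>" by (auto intro: feqI)
  moreover have "feq (pb E p (p \<cdot> \<gamma>) C) (?K \<cdot> \<xi>) (cmp_str \<cdot> fpair pr1 (?K \<cdot> pr2))"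
    by (auto intro!: feqI simp: \<gamma>_\<xi>_Obj \<xi>_Arr rep_obj_\<xi> rep_arr_\<xi>)
  moreover have "feq pulled (?K \<cdot> \<xi>) fid"
    using sub by (auto intro!: feqI simp: \<gamma>_\<xi>_Obj \<xi>_Arr rep_obj_\<xi> rep_arr_\<xi> rep_id)
  moreover have "feq C (\<xi> \<cdot> ?K) fid"
    by (auto intro!: feqI simp: \<xi>_rep_obj \<xi>_rep_arr \<xi>_unit_Obj \<xi>_unit_Arr p\<gamma>_simps)
  ultimately show ?thesis
    using fun_\<xi>_descended unfolding descent_isomorphism_def descent_morphism_def by blast
qed

end

theorem (in triple_lifting) effective_descent: "effective_descent TYPE('u) E B p"
  unfolding effective_descent_def
proof (intro conjI allI impI; (elim conjE)?)
  show "is_functor E B p" by (rule fun_p)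
next
  fix X Y :: "('u, 'u) cat" and \<delta> \<epsilon> F F'
  assume "is_functor X B \<delta>" "feq (pb E p \<delta> X) (cmp_map F) (cmp_map F')"
  then show "feq X F F'" by (rule comparison_faithful)
next
  fix X Y :: "('u, 'u) cat" and \<delta> \<epsilon> H
  assume "is_functor X B \<delta>" "is_functor Y B \<epsilon>"
    "descent_morphism E B p (pb E p \<delta> X) pr1 cmp_str (pb E p \<epsilon> Y) pr1 cmp_str H"
  then show "\<exists>F. slice_morphism X \<delta> Y \<epsilon> F \<and> feq (pb E p \<delta> X) H (cmp_map F)"
    by (rule comparison_full)
next
  fix C :: "('u, 'u) cat" and \<gamma> \<xi>
  assume "descent_datum E B p C \<gamma> \<xi>"
  then interpret descent E B p C \<gamma> \<xi> by unfold_locales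
  show "\<exists>(X :: ('u, 'u) cat) \<delta> H. is_functor X B \<delta> \<and>
      descent_isomorphism E B p (pb E p \<delta> X) pr1 cmp_str C \<gamma> \<xi> H"
    using fun_descended descent_isomorphism_\<xi> by blast
qed

section \<open>Ordered categories as double categories\<close>

lemma poset_cat_simps [simp]:
  "Obj (poset_cat S le) = S"
  "u \<in> Arr (poset_cat S le) \<longleftrightarrow> fst u \<in> S \<and> snd u \<in> S \<and> le (fst u) (snd u)"
  "Dom (poset_cat S le) = fst"
  "Cod (poset_cat S le) = snd"
  "Ide (poset_cat S le) x = (x, x)"
  "Cmp (poset_cat S le) v u = (fst u, snd v)"
  by (auto simp: poset_cat_def)

lemma poset_fnct_simps [simp]:
  "OMap (poset_fnct m) = m" "AMap (poset_fnct m) u = (m (fst u), m (snd u))"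
  by (simp_all add: poset_fnct_def map_prod_def split: prod.split)

lemma category_poset_cat:
  assumes "\<And>x. x \<in> S \<Longrightarrow> le x x"
    and "\<And>x y z. \<lbrakk>x \<in> S; y \<in> S; z \<in> S; le x y; le y z\<rbrakk> \<Longrightarrow> le x z"
  shows "category (poset_cat S le)"
  by standard (simp_all add: assms(1), metis assms(2))

lemma functor_poset_fnct:
  assumes "category (poset_cat S le)" "category (poset_cat S' le')"
    and "\<And>x. x \<in> S \<Longrightarrow> m x \<in> S'"
    and "\<And>x y. \<lbrakk>x \<in> S; y \<in> S; le x y\<rbrakk> \<Longrightarrow> le' (m x) (m y)"
  shows "is_functor (poset_cat S le) (poset_cat S' le') (poset_fnct m)"
  by (rule is_functorI) (simp_all add: assms)

lemma double_of_simps [simp]: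
  "Cat0 (double_of G) = poset_cat (Obj G) (ObjLeq G)"
  "Cat1 (double_of G) = poset_cat (Arr G) (Leq G)"
  "Src (double_of G) = poset_fnct (Dom G)"
  "Tgt (double_of G) = poset_fnct (Cod G)"
  "Unt (double_of G) = poset_fnct (Ide G)"
  "OMap (Mul (double_of G)) x = Cmp G (snd x) (fst x)"
  "AMap (Mul (double_of G)) u =
    (Cmp G (fst (snd u)) (fst (fst u)), Cmp G (snd (snd u)) (snd (fst u)))"
  by (auto simp: double_of_def split: prod.split)

text \<open>The structure shared by \<open>G\<close> and \<open>GL(G)\<close> from which
  \<open>double_of\<close> is built, so that one lemma yields both double categories.\<close>

locale ordered_category = category H for H :: "('o, 'a) ogpd" +
  assumes Leq_refl: "f \<in> Arr H \<Longrightarrow> Leq H f f"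
    and Leq_trans: "\<lbrakk>f \<in> Arr H; g \<in> Arr H; h \<in> Arr H; Leq H f g; Leq H g h\<rbrakk> \<Longrightarrow> Leq H f h"
    and Leq_Dom: "\<lbrakk>f \<in> Arr H; g \<in> Arr H; Leq H f g\<rbrakk> \<Longrightarrow> ObjLeq H (Dom H f) (Dom H g)"
    and Leq_Cod: "\<lbrakk>f \<in> Arr H; g \<in> Arr H; Leq H f g\<rbrakk> \<Longrightarrow> ObjLeq H (Cod H f) (Cod H g)"
    and Leq_Cmp: "\<lbrakk>a \<in> Arr H; b \<in> Arr H; c \<in> Arr H; d \<in> Arr H; Leq H a b; Leq H c d;
      Dom H a = Cod H c; Dom H b = Cod H d\<rbrakk> \<Longrightarrow> Leq H (Cmp H a c) (Cmp H b d)"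
begin

lemma ObjLeq_refl: "A \<in> Obj H \<Longrightarrow> ObjLeq H A A"
  unfolding ObjLeq_def by (simp add: Leq_refl Ide_in)

lemma ObjLeq_trans:
  "\<lbrakk>A \<in> Obj H; B \<in> Obj H; C \<in> Obj H; ObjLeq H A B; ObjLeq H B C\<rbrakk> \<Longrightarrow> ObjLeq H A C"
  unfolding ObjLeq_def by (rule Leq_trans) (simp_all add: Ide_in)

lemma category_objects: "category (poset_cat (Obj H) (ObjLeq H))"
  using ObjLeq_refl ObjLeq_trans by (rule category_poset_cat)

lemma category_arrows: "category (poset_cat (Arr H) (Leq H))"
  using Leq_refl Leq_trans by (rule category_poset_cat)

lemma functor_Src: "is_functor (poset_cat (Arr H) (Leq H)) (poset_cat (Obj H) (ObjLeq H)) (poset_fnct (Dom H))"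
  and functor_Tgt: "is_functor (poset_cat (Arr H) (Leq H)) (poset_cat (Obj H) (ObjLeq H)) (poset_fnct (Cod H))"
  using category_arrows category_objects Dom_in Cod_in Leq_Dom Leq_Cod
  by (simp_all add: functor_poset_fnct)

lemma functor_Unt: "is_functor (poset_cat (Obj H) (ObjLeq H)) (poset_cat (Arr H) (Leq H)) (poset_fnct (Ide H))"
  by (rule functor_poset_fnct[OF category_objects category_arrows Ide_in]) (simp_all add: ObjLeq_def)

lemma is_double_category_double_of: "is_double_category (double_of H)"
proof -
  note simps = Ide_in Dom_in Cod_in Cmp_in Dom_Ide Cod_Ide Dom_Cmp Cod_Cmp Cmp_Ide_left Cmp_Ide_right
    Cmp_assoc Leq_Cmp
  have "is_functor (composables (double_of H)) (Cat1 (double_of H)) (Mul (double_of H))"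
    unfolding composables_def double_of_simps
    by (rule is_functorI) (auto simp: category_pb[OF functor_Tgt functor_Src] category_arrows simps)
  then show ?thesis
    unfolding is_double_category_def
    using functor_Src functor_Tgt functor_Unt
    by (auto intro!: feqI simp: composables_def simps)
qed

end

section \<open>Ordered groupoids and their category of subobjects\<close>

context ordered_groupoid
begin

section \<open>Inverses and restrictions in an ordered groupoid\<close>

lemma inverse_arrows_unique:
  assumes "inverse_arrows G f g" "inverse_arrows G f g'"
  shows "g = g'"
proof -
  have "g = Cmp G g (Cmp G f g')"
    using assms Cmp_Ide_right[of g] by (simp add: inverse_arrows_def)
  also have "\<dots> = Cmp G (Cmp G g f) g'"
    using assms Cmp_assoc[of g' f g] by (simp add: inverse_arrows_def)
  also have "\<dots> = g'"
    using assms Cmp_Ide_left[of g'] by (simp add: inverse_arrows_def)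
  finally show ?thesis .
qed

lemma inverse_arrows_Inv: "f \<in> Arr G \<Longrightarrow> inverse_arrows G f (Inv G f)"
  using all_iso[of f] unfolding iso_def Inv_def by (metis inverse_arrows_unique theI)

lemma
  assumes "f \<in> Arr G"
  shows Inv_in: "Inv G f \<in> Arr G"
    and Dom_Inv: "Dom G (Inv G f) = Cod G f"
    and Cod_Inv: "Cod G (Inv G f) = Dom G f"
    and Cmp_Inv_left: "Cmp G (Inv G f) f = Ide G (Dom G f)"
    and Cmp_Inv_right: "Cmp G f (Inv G f) = Ide G (Cod G f)"
  using inverse_arrows_Inv[OF assms] by (simp_all add: inverse_arrows_def)

lemma Cmp_Inv_Cmp:
  assumes "f \<in> Arr G" "h \<in> Arr G" "Cod G f = Cod G h"
  shows "Cmp G h (Cmp G (Inv G h) f) = f"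
  using assms Cmp_assoc[of f "Inv G h" h] Cmp_Ide_left[of f]
  by (simp add: Inv_in Dom_Inv Cod_Inv Cmp_Inv_right)

lemma Cmp_Cmp_Inv:
  assumes "f \<in> Arr G" "h \<in> Arr G" "Dom G f = Dom G h"
  shows "Cmp G (Cmp G f (Inv G h)) h = f"
  using assms Cmp_assoc[of h "Inv G h" f] Cmp_Ide_right[of f]
  by (simp add: Inv_in Dom_Inv Cod_Inv Cmp_Inv_left)

lemma Cmp_right_cancel:
  assumes "f \<in> Arr G" "g \<in> Arr G" "h \<in> Arr G" "Dom G f = Cod G h" "Dom G g = Cod G h"
    and "Cmp G f h = Cmp G g h"
  shows "f = g"
proof -
  have "Cmp G (Cmp G k h) (Inv G h) = k" if "k \<in> Arr G" "Dom G k = Cod G h" for k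
    using that assms(3) Cmp_assoc[of "Inv G h" h k] Cmp_Ide_right[of k]
    by (simp add: Inv_in Dom_Inv Cod_Inv Cmp_Inv_right)
  then show ?thesis using assms by metis
qed

text \<open>For \<open>f\<close> below \<open>g\<close>, the identities on the sources are the
  composites of inverse with arrow, and those on the targets the composites of arrow with inverse.
  Monotonicity of inversion and composition compares them.\<close>

sublocale ordered_category G
proof
  fix f g assume fg: "f \<in> Arr G" "g \<in> Arr G" "Leq G f g"
  note Inv_fg = Inv_in[OF fg(1)] Inv_in[OF fg(2)] Leq_Inv[OF fg]
  show "ObjLeq G (Dom G f) (Dom G g)"
    using Leq_Cmp[OF Inv_fg(1,2) fg(1,2) Inv_fg(3) fg(3)] fg
    by (simp add: ObjLeq_def Dom_Inv Cmp_Inv_left)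
  show "ObjLeq G (Cod G f) (Cod G g)"
    using Leq_Cmp[OF fg(1,2) Inv_fg(1,2) fg(3) Inv_fg(3)] fg
    by (simp add: ObjLeq_def Cod_Inv Cmp_Inv_right)
qed (fact Leq_refl Leq_trans Leq_Cmp)+

lemma Ide_inject: "\<lbrakk>A \<in> Obj G; B \<in> Obj G; Ide G A = Ide G B\<rbrakk> \<Longrightarrow> A = B"
  using Dom_Ide by metis

lemma ObjLeq_antisym: "\<lbrakk>A \<in> Obj G; B \<in> Obj G; ObjLeq G A B; ObjLeq G B A\<rbrakk> \<Longrightarrow> A = B"
  unfolding ObjLeq_def using Leq_antisym Ide_in Ide_inject by metis

lemma restr:
  assumes "f \<in> Arr G" "A \<in> Obj G" "ObjLeq G A (Dom G f)"
  shows "restr G f A \<in> Arr G" "Dom G (restr G f A) = A" "Leq G (restr G f A) f"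
  using theI'[OF restriction[OF assms]] unfolding restr_def by blast+

lemma restr_eqI:
  assumes "f \<in> Arr G" "f' \<in> Arr G" "Leq G f' f"
  shows "restr G f (Dom G f') = f'"
  using restriction[OF assms(1) Dom_in[OF assms(2)] Leq_Dom[OF assms(2,1,3)]] assms
  unfolding restr_def by (intro the1_equality) auto

lemma restr_Dom: "f \<in> Arr G \<Longrightarrow> restr G f (Dom G f) = f"
  by (simp add: restr_eqI Leq_refl)

text \<open>The composite of the restrictions has source \<open>A\<close> and lies below the
  composite, so uniqueness of restrictions identifies it.\<close>

lemma restr_Cmp:
  assumes "f \<in> Arr G" "g \<in> Arr G" "Dom G g = Cod G f" "A \<in> Obj G" "ObjLeq G A (Dom G f)"
  shows "restr G (Cmp G g f) A = Cmp G (restr G g (Cod G (restr G f A))) (restr G f A)"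
proof -
  note f' = restr[OF assms(1,4,5)]
  have "ObjLeq G (Cod G (restr G f A)) (Dom G g)" using Leq_Cod[OF f'(1) assms(1) f'(3)] assms(3) by simp
  note g' = restr[OF assms(2) Cod_in[OF f'(1)] this]
  show ?thesis
    using restr_eqI[OF Cmp_in[OF assms(1,2,3)] Cmp_in[OF f'(1) g'(1,2)]
        Leq_Cmp[OF g'(1) assms(2) f'(1) assms(1) g'(3) f'(3) g'(2) assms(3)]] f' g'
    by (simp add: Dom_Cmp)
qed

section \<open>Isomorphisms, subobjects and spans in \<open>L(G)\<close>\<close>

lemma L_cat_simps [simp]:
  "Obj (L_cat G) = Obj G"
  "m \<in> Arr (L_cat G) \<longleftrightarrow> fst m \<in> Arr G \<and> snd m \<in> Obj G \<and> ObjLeq G (Cod G (fst m)) (snd m)"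
  "Dom (L_cat G) m = Dom G (fst m)"
  "Cod (L_cat G) m = snd m"
  "Ide (L_cat G) A = (Ide G A, A)"
  "Cmp (L_cat G) n m = (Cmp G (restr G (fst n) (Cod G (fst m))) (fst m), snd n)"
  by (auto simp: L_cat_def split: prod.splits)

text \<open>If a restriction of \<open>h\<close> occurs in a composite equal to the identity on
  \<open>B\<close>, its target is \<open>B\<close>; monotonicity of targets gives that
  \<open>B\<close> is below the target of \<open>h\<close>, and antisymmetry gives equality.
  Conversely the groupoid inverse works.\<close>

lemma iso_L_cat: "iso (L_cat G) m \<longleftrightarrow> fst m \<in> Arr G \<and> Cod G (fst m) = snd m"
proof
  assume "iso (L_cat G) m"
  then obtain n where n: "inverse_arrows (L_cat G) m n" unfolding iso_def by blast
  let ?k = "restr G (fst m) (Cod G (fst n))"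
  have m: "fst m \<in> Arr G" "snd m \<in> Obj G" "ObjLeq G (Cod G (fst m)) (snd m)"
    and n': "fst n \<in> Arr G" "ObjLeq G (Cod G (fst n)) (Dom G (fst m))" "Dom G (fst n) = snd m"
    and eq: "Cmp G ?k (fst n) = Ide G (snd m)"
    using n by (auto simp: inverse_arrows_def)
  note k = restr[OF m(1) Cod_in[OF n'(1)] n'(2)]
  have "Cod G ?k = snd m"
    using Cod_Cmp[OF n'(1) k(1,2)] eq m by (simp add: Cod_Ide)
  then have "ObjLeq G (snd m) (Cod G (fst m))" using Leq_Cod[OF k(1) m(1) k(3)] by simp
  then show "fst m \<in> Arr G \<and> Cod G (fst m) = snd m"
    using m ObjLeq_antisym Cod_in by blast
next
  assume m: "fst m \<in> Arr G \<and> Cod G (fst m) = snd m"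
  then have "restr G (fst m) (Dom G (fst m)) = fst m"
      "restr G (Inv G (fst m)) (snd m) = Inv G (fst m)"
    using restr_Dom[of "Inv G (fst m)"] by (simp_all add: restr_Dom Inv_in Dom_Inv)
  then have "inverse_arrows (L_cat G) m (Inv G (fst m), Dom G (fst m))"
    using m Cod_in[of "fst m"] unfolding inverse_arrows_def
    by (simp add: Inv_in Dom_Inv Cod_Inv Dom_in ObjLeq_refl Cmp_Inv_left Cmp_Inv_right)
  then show "iso (L_cat G) m" unfolding iso_def by blast
qed

text \<open>\<open>sub B' B\<close> is the object \<open>(B', B)\<close> of \<open>GL(G)\<close>, and \<open>spn g B C\<close> the arrow
  \<open>g : (B', B) \<rightarrow> (C', C)\<close>, with \<open>B'\<close> and \<open>C'\<close> the domain and codomain of \<open>g\<close>.\<close>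

definition sub :: "'o \<Rightarrow> 'o \<Rightarrow> ('a \<times> 'o) set" where
  "sub B' B = {(f, B) | f. f \<in> Arr G \<and> Cod G f = B'}"

definition spn :: "'a \<Rightarrow> 'o \<Rightarrow> 'o \<Rightarrow> (('a \<times> 'o) \<times> ('a \<times> 'o)) set" where
  "spn g B C = {((f, B), (Cmp G g f, C)) | f. f \<in> Arr G \<and> Cod G f = Dom G g}"

definition fits :: "'a \<Rightarrow> 'o \<Rightarrow> 'o \<Rightarrow> bool" where
  "fits g B C \<longleftrightarrow> g \<in> Arr G \<and> B \<in> Obj G \<and> C \<in> Obj G \<and>
     ObjLeq G (Dom G g) B \<and> ObjLeq G (Cod G g) C"

text \<open>Any arrow \<open>f\<close> with the same target as \<open>h\<close> factors through
  \<open>h\<close>, with the isomorphism \<open>Cmp G (Inv G h) f\<close>, so the class remembers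
  only the target of \<open>h\<close> and the bound.\<close>

lemma subobj_L_cat:
  assumes "h \<in> Arr G"
  shows "subobj (L_cat G) (h, B) = sub (Cod G h) B"
proof (intro subset_antisym subsetI)
  fix x assume "x \<in> sub (Cod G h) B"
  then obtain f where f: "x = (f, B)" "f \<in> Arr G" "Cod G f = Cod G h" unfolding sub_def by blast
  then show "x \<in> subobj (L_cat G) (h, B)"
    unfolding subobj_def iso_L_cat using assms
    by (auto intro!: exI[of _ "Cmp G (Inv G h) f"]
        simp: restr_Dom Cmp_Inv_Cmp Inv_in Cmp_in Dom_Inv Cod_Cmp Cod_Inv)
qed (use assms in \<open>auto simp: subobj_def iso_L_cat sub_def restr_Dom Cmp_in Cod_Cmp\<close>)

text \<open>Reparametrising the apex by the inverse of \<open>h\<close> turns the left leg into an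
  identity and the right leg into \<open>Cmp G k (Inv G h)\<close>; the class is the graph of
  composition with that arrow.\<close>

lemma span_L_cat:
  assumes "h \<in> Arr G" "k \<in> Arr G" "Dom G h = Dom G k"
  shows "span (L_cat G) (h, B) (k, C) = spn (Cmp G k (Inv G h)) B C"
proof -
  have restr: "restr G h (Dom G k) = h" using restr_Dom[OF assms(1)] assms(3) by simp
  have Dom: "Dom G (Cmp G k (Inv G h)) = Cod G h"
    using assms by (simp add: Inv_in Dom_Cmp Dom_Inv Cod_Inv)
  show ?thesis
  proof (intro subset_antisym subsetI)
    fix x assume "x \<in> spn (Cmp G k (Inv G h)) B C"
    then obtain f where f: "x = ((f, B), (Cmp G (Cmp G k (Inv G h)) f, C))" "f \<in> Arr G" "Cod G f = Cod G h"
      unfolding spn_def Dom by blast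
    have "Cmp G (Cmp G k (Inv G h)) f = Cmp G k (Cmp G (Inv G h) f)"
      using f assms by (simp add: Cmp_assoc Inv_in Dom_Inv Cod_Inv)
    then show "x \<in> span (L_cat G) (h, B) (k, C)"
      unfolding span_def iso_L_cat using assms f
      by (auto intro!: exI[of _ "Cmp G (Inv G h) f"]
          simp: restr_Dom restr Cmp_Inv_Cmp Inv_in Cmp_in Dom_Inv Cod_Cmp Cod_Inv)
  next
    fix x assume "x \<in> span (L_cat G) (h, B) (k, C)"
    then obtain i where i: "i \<in> Arr G" "Cod G i = Dom G h" "x = ((Cmp G h i, B), (Cmp G k i, C))"
      using assms by (auto simp: span_def iso_L_cat restr_Dom restr)
    have "Cmp G (Cmp G k (Inv G h)) (Cmp G h i) = Cmp G k i"
      using Cmp_assoc[of i h "Cmp G k (Inv G h)"] i assms Dom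
      by (simp add: Cmp_Cmp_Inv Cmp_in Inv_in Dom_Inv Cod_Inv)
    then show "x \<in> spn (Cmp G k (Inv G h)) B C"
      using i assms Dom by (auto simp: spn_def Cmp_in Cod_Cmp)
  qed
qed

section \<open>The structure of \<open>GL(G)\<close> computed on normal forms\<close>

abbreviation GL :: "(('a \<times> 'o) set, (('a \<times> 'o) \<times> ('a \<times> 'o)) set) ogpd" where
  "GL \<equiv> G_ogpd (L_cat G)"

lemma Obj_GL: "Obj GL = {sub B' B | B' B. B' \<in> Obj G \<and> B \<in> Obj G \<and> ObjLeq G B' B}"
proof (intro subset_antisym subsetI)
  fix X assume "X \<in> {sub B' B | B' B. B' \<in> Obj G \<and> B \<in> Obj G \<and> ObjLeq G B' B}"
  then obtain B' B where "X = sub B' B" "B' \<in> Obj G" "B \<in> Obj G" "ObjLeq G B' B" by blast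
  then have "X = subobj (L_cat G) (Ide G B', B)" "(Ide G B', B) \<in> Arr (L_cat G)"
    by (simp_all add: subobj_L_cat Ide_in Cod_Ide)
  then show "X \<in> Obj GL" unfolding G_ogpd_def by auto
qed (use Cod_in in \<open>force simp: G_ogpd_def subobj_L_cat\<close>)

lemma Arr_GL: "Arr GL = {spn g B C | g B C. fits g B C}"
proof (intro subset_antisym subsetI)
  fix X assume "X \<in> {spn g B C | g B C. fits g B C}"
  then obtain g B C where X: "X = spn g B C" "fits g B C" by blast
  then have "X = span (L_cat G) (Ide G (Dom G g), B) (g, C)"
    using Cmp_Cmp_Inv[of g "Ide G (Dom G g)"] Cmp_Ide_right[of "Cmp G g (Inv G (Ide G (Dom G g)))"]
    by (simp add: fits_def span_L_cat Ide_in Dom_in Dom_Ide Cod_Ide Cmp_in Inv_in Dom_Inv Cod_Inv Dom_Cmp)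
  moreover have "(Ide G (Dom G g), B) \<in> Arr (L_cat G)" "(g, C) \<in> Arr (L_cat G)"
      "Dom (L_cat G) (Ide G (Dom G g), B) = Dom (L_cat G) (g, C)"
    using X by (simp_all add: fits_def Ide_in Dom_in Cod_Ide Dom_Ide)
  ultimately show "X \<in> Arr GL" unfolding G_ogpd_def ogpd.simps cat.simps by blast
next
  fix X assume "X \<in> Arr GL"
  then obtain m n where mn: "X = span (L_cat G) m n" "m \<in> Arr (L_cat G)" "n \<in> Arr (L_cat G)"
      "Dom (L_cat G) m = Dom (L_cat G) n" unfolding G_ogpd_def by auto
  then have "X = spn (Cmp G (fst n) (Inv G (fst m))) (snd m) (snd n)"
    using span_L_cat[of "fst m" "fst n" "snd m" "snd n"] by simp
  moreover have "fits (Cmp G (fst n) (Inv G (fst m))) (snd m) (snd n)"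
    using mn by (simp add: fits_def Cmp_in Inv_in Dom_Cmp Cod_Cmp Dom_Inv Cod_Inv)
  ultimately show "X \<in> {spn g B C | g B C. fits g B C}" by blast
qed

lemma GL_ObjE:
  assumes "X \<in> Obj GL"
  obtains B' B where "X = sub B' B" "B' \<in> Obj G" "B \<in> Obj G" "ObjLeq G B' B"
  using assms unfolding Obj_GL by blast

lemma GL_ArrE:
  assumes "X \<in> Arr GL"
  obtains g B C where "X = spn g B C" "fits g B C"
  using assms unfolding Arr_GL by blast

lemma sub_in: "\<lbrakk>B' \<in> Obj G; B \<in> Obj G; ObjLeq G B' B\<rbrakk> \<Longrightarrow> sub B' B \<in> Obj GL"
  unfolding Obj_GL by blast

lemma spn_in: "fits g B C \<Longrightarrow> spn g B C \<in> Arr GL"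
  unfolding Arr_GL by blast

lemma Dom_GL: "g \<in> Arr G \<Longrightarrow> Dom GL (spn g B C) = sub (Dom G g) B"
  by (auto simp: G_ogpd_def spn_def sub_def)

lemma Cod_GL: "g \<in> Arr G \<Longrightarrow> Cod GL (spn g B C) = sub (Cod G g) C"
proof -
  assume g: "g \<in> Arr G"
  have "\<exists>f'. f = Cmp G g f' \<and> f' \<in> Arr G \<and> Cod G f' = Dom G g" if "f \<in> Arr G" "Cod G f = Cod G g" for f
    using that g by (intro exI[of _ "Cmp G (Inv G g) f"])
      (simp add: Cmp_Inv_Cmp Cmp_in Cod_Cmp Inv_in Dom_Inv Cod_Inv)
  then show ?thesis using g by (fastforce simp: G_ogpd_def spn_def sub_def Cmp_in Cod_Cmp)
qed

lemma Ide_GL: "A \<in> Obj G \<Longrightarrow> Ide GL (sub A B) = spn (Ide G A) B B"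
  by (auto simp: G_ogpd_def spn_def sub_def Id_on_def Dom_Ide Cmp_Ide_left)

lemma Cmp_GL:
  assumes "g \<in> Arr G" "g' \<in> Arr G" "Dom G g' = Cod G g"
  shows "Cmp GL (spn g' C D) (spn g B C) = spn (Cmp G g' g) B D"
  using assms by (auto simp: G_ogpd_def spn_def relcomp_unfold Dom_Cmp Cod_Cmp Cmp_in Cmp_assoc)

text \<open>The definition compares arbitrary representatives. Cancelling the common left leg, which
  is possible in a groupoid, leaves \<open>g\<close> as a restriction of \<open>g'\<close>.\<close>

lemma Leq_GL:
  assumes "g \<in> Arr G" "g' \<in> Arr G"
  shows "Leq GL (spn g B C) (spn g' B' C') \<longleftrightarrow> B = B' \<and> C = C' \<and> Leq G g g'"
proof
  assume "Leq GL (spn g B C) (spn g' B' C')"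
  then obtain f f' k where f: "f \<in> Arr G" "Cod G f = Dom G g"
      and f': "f' \<in> Arr G" "Cod G f' = Dom G g'"
      and k: "k \<in> Arr G" "ObjLeq G (Cod G k) (Dom G f')"
      and eq: "B = B'" "C = C'" "f = Cmp G (restr G f' (Cod G k)) k"
        "Cmp G g f = Cmp G (restr G (Cmp G g' f') (Cod G k)) k"
    by (auto simp: G_ogpd_def spn_def)
  \<comment> \<open>Composition in \<open>L(G)\<close> restricts both legs to the target of
    \<open>k\<close>: the left leg becomes \<open>r\<close>, the right leg \<open>r\<close> followed
    by a restriction of \<open>g'\<close>.\<close>
  define r where "r = restr G f' (Cod G k)"
  have r: "r \<in> Arr G" "Dom G r = Cod G k" "Leq G r f'"
    unfolding r_def using restr[OF f'(1) Cod_in[OF k(1)] k(2)] by simp_all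
  have fr: "f = Cmp G r k" "Cod G f = Cod G r" using eq(3) k r by (simp_all add: r_def Cod_Cmp)
  have "ObjLeq G (Cod G r) (Dom G g')" using Leq_Cod[OF r(1) f'(1) r(3)] f' by simp
  note s = restr[OF assms(2) Cod_in[OF r(1)] this]
  have "Cmp G g f = Cmp G (Cmp G (restr G g' (Cod G r)) r) k"
    using eq(4) restr_Cmp[OF f'(1) assms(2) _ Cod_in[OF k(1)] k(2)] f' by (simp add: r_def)
  also have "\<dots> = Cmp G (restr G g' (Cod G r)) f"
    using Cmp_assoc[of k r "restr G g' (Cod G r)"] k r s fr by simp
  finally have "g = restr G g' (Cod G r)"
    by (rule Cmp_right_cancel[OF assms(1) s(1) f(1) f(2)[symmetric] trans[OF s(2) fr(2)[symmetric]]])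
  then show "B = B' \<and> C = C' \<and> Leq G g g'" using eq s by metis
next
  assume *: "B = B' \<and> C = C' \<and> Leq G g g'"
  have D: "Dom G g \<in> Obj G" "Dom G g' \<in> Obj G" "ObjLeq G (Dom G g) (Dom G g')"
    using assms * by (simp_all add: Dom_in Leq_Dom)
  \<comment> \<open>The common factor is the identity on the source of \<open>g\<close>, read in
    \<open>L(G)\<close> as an inclusion into the source of \<open>g'\<close>. Along it the identity
    leg restricts to an identity and \<open>g'\<close> restricts to \<open>g\<close>.\<close>
  have "restr G (Ide G (Dom G g')) (Dom G g) = Ide G (Dom G g)" "restr G g' (Dom G g) = g"
    using restr_eqI[of "Ide G (Dom G g')" "Ide G (Dom G g)"] restr_eqI[of g' g] D assms *
    by (simp_all add: ObjLeq_def Ide_in Dom_Ide)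
  then have eqs: "(Ide G (Dom G g), B) = Cmp (L_cat G) (Ide G (Dom G g'), B') (Ide G (Dom G g), Dom G g')"
      "(g, C) = Cmp (L_cat G) (g', C') (Ide G (Dom G g), Dom G g')"
    using D assms * Cmp_Ide_left[of "Ide G (Dom G g)"] by (simp_all add: Cod_Ide Ide_in Cmp_Ide_right)
  have "((Ide G (Dom G g), B), (g, C)) \<in> spn g B C"
      "((Ide G (Dom G g'), B'), (g', C')) \<in> spn g' B' C'"
    using D assms by (auto simp: spn_def Ide_in Cod_Ide Cmp_Ide_right intro!: exI[of _ "Ide G (Dom G _)"])
  moreover have "(Ide G (Dom G g), Dom G g') \<in> Arr (L_cat G)"
      "Cod (L_cat G) (Ide G (Dom G g), Dom G g') = Dom (L_cat G) (Ide G (Dom G g'), B')"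
    using D by (simp_all add: Ide_in Cod_Ide Dom_Ide)
  ultimately show "Leq GL (spn g B C) (spn g' B' C')"
    unfolding G_ogpd_def ogpd.simps using eqs by blast
qed

lemma ObjLeq_GL:
  assumes "A \<in> Obj G" "A' \<in> Obj G"
  shows "ObjLeq GL (sub A B) (sub A' B') \<longleftrightarrow> B = B' \<and> ObjLeq G A A'"
  using assms by (simp add: ObjLeq_def Ide_GL Leq_GL Ide_in)

lemma kappa_obj_sub: "A \<in> Obj G \<Longrightarrow> kappa_obj G (sub A B) = A"
  unfolding kappa_obj_def sub_def by (rule the_equality) (auto simp: Ide_in Cod_Ide)

lemma kappa_arr_spn: "g \<in> Arr G \<Longrightarrow> kappa_arr G (spn g B C) = g"
  unfolding kappa_arr_def spn_def
  by (rule the_equality) (auto simp: Ide_in Cod_Ide Dom_in Cmp_Ide_right)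

lemma sub_eq_iff: "\<lbrakk>A \<in> Obj G; A' \<in> Obj G\<rbrakk> \<Longrightarrow> sub A B = sub A' B' \<longleftrightarrow> A = A' \<and> B = B'"
  by (auto simp: sub_def set_eq_iff) (metis Ide_in Cod_Ide)+

text \<open>On normal forms each law is the one of \<open>G\<close> for the groupoid arrows, with
  the bounds carried along. When a target equals a source, \<open>sub_eq_iff\<close> makes both the
  groupoid objects and the bounds agree.\<close>

sublocale GL: ordered_category GL
proof
  fix X assume "X \<in> Arr GL"
  then obtain g B C where X: "X = spn g B C" "fits g B C" by (rule GL_ArrE)
  then show "Dom GL X \<in> Obj GL" "Cod GL X \<in> Obj GL" "Cmp GL X (Ide GL (Dom GL X)) = X"
      "Cmp GL (Ide GL (Cod GL X)) X = X" "Leq GL X X"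
    by (simp_all add: fits_def Dom_GL Cod_GL sub_in Dom_in Cod_in Ide_GL Cmp_GL Ide_in Dom_Ide Cod_Ide
        Cmp_Ide_left Cmp_Ide_right Leq_GL Leq_refl)
next
  fix X assume "X \<in> Obj GL"
  then obtain A B where X: "X = sub A B" "A \<in> Obj G" "B \<in> Obj G" "ObjLeq G A B" by (rule GL_ObjE)
  then show "Ide GL X \<in> Arr GL" "Dom GL (Ide GL X) = X" "Cod GL (Ide GL X) = X"
    by (simp_all add: Ide_GL spn_in fits_def Ide_in Dom_Ide Cod_Ide Dom_GL Cod_GL)
next
  fix X Y assume XY: "X \<in> Arr GL" "Y \<in> Arr GL" "Dom GL Y = Cod GL X"
  from XY(1) obtain g B C where X: "X = spn g B C" "fits g B C" by (rule GL_ArrE)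
  from XY(2) obtain g' C' D where Y: "Y = spn g' C' D" "fits g' C' D" by (rule GL_ArrE)
  have "Dom G g' = Cod G g" "C' = C"
    using XY(3) X Y by (simp_all add: Dom_GL Cod_GL fits_def sub_eq_iff Dom_in Cod_in)
  then show "Cmp GL Y X \<in> Arr GL" "Dom GL (Cmp GL Y X) = Dom GL X" "Cod GL (Cmp GL Y X) = Cod GL Y"
    using X Y by (simp_all add: fits_def Cmp_GL spn_in Cmp_in Dom_Cmp Cod_Cmp Dom_GL Cod_GL)
next
  fix X Y Z assume XYZ: "X \<in> Arr GL" "Y \<in> Arr GL" "Z \<in> Arr GL" "Dom GL Y = Cod GL X" "Dom GL Z = Cod GL Y"
  from XYZ(1) obtain g B C where X: "X = spn g B C" "fits g B C" by (rule GL_ArrE)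
  from XYZ(2) obtain g' C' D where Y: "Y = spn g' C' D" "fits g' C' D" by (rule GL_ArrE)
  from XYZ(3) obtain g'' D' E where Z: "Z = spn g'' D' E" "fits g'' D' E" by (rule GL_ArrE)
  have "Dom G g' = Cod G g" "C' = C" "Dom G g'' = Cod G g'" "D' = D"
    using XYZ(4,5) X Y Z by (simp_all add: Dom_GL Cod_GL fits_def sub_eq_iff Dom_in Cod_in)
  then show "Cmp GL (Cmp GL Z Y) X = Cmp GL Z (Cmp GL Y X)"
    using X Y Z by (simp add: fits_def Cmp_GL Cmp_in Dom_Cmp Cod_Cmp Cmp_assoc)
next
  fix X Y Z assume XYZ: "X \<in> Arr GL" "Y \<in> Arr GL" "Z \<in> Arr GL" "Leq GL X Y" "Leq GL Y Z"
  from XYZ(1) obtain g B C where X: "X = spn g B C" "fits g B C" by (rule GL_ArrE)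
  from XYZ(2) obtain g' B' C' where Y: "Y = spn g' B' C'" "fits g' B' C'" by (rule GL_ArrE)
  from XYZ(3) obtain g'' B'' C'' where Z: "Z = spn g'' B'' C''" "fits g'' B'' C''" by (rule GL_ArrE)
  show "Leq GL X Z"
    using XYZ(4,5) X Y Z Leq_trans[of g g' g''] by (simp add: fits_def Leq_GL)
next
  fix X Y assume XY: "X \<in> Arr GL" "Y \<in> Arr GL" "Leq GL X Y"
  from XY(1) obtain g B C where X: "X = spn g B C" "fits g B C" by (rule GL_ArrE)
  from XY(2) obtain g' B' C' where Y: "Y = spn g' B' C'" "fits g' B' C'" by (rule GL_ArrE)
  show "ObjLeq GL (Dom GL X) (Dom GL Y)" "ObjLeq GL (Cod GL X) (Cod GL Y)"
    using XY(3) X Y by (simp_all add: fits_def Leq_GL Dom_GL Cod_GL ObjLeq_GL Dom_in Cod_in Leq_Dom Leq_Cod)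
next
  fix W X Y Z
  assume "W \<in> Arr GL" "X \<in> Arr GL" "Y \<in> Arr GL" "Z \<in> Arr GL"
    and le: "Leq GL W X" "Leq GL Y Z" "Dom GL W = Cod GL Y" "Dom GL X = Cod GL Z"
  then obtain w B1 C1 x B2 C2 y B3 C3 z B4 C4
    where W: "W = spn w B1 C1" "fits w B1 C1" and X: "X = spn x B2 C2" "fits x B2 C2"
      and Y: "Y = spn y B3 C3" "fits y B3 C3" and Z: "Z = spn z B4 C4" "fits z B4 C4"
    by (elim GL_ArrE)
  then show "Leq GL (Cmp GL W Y) (Cmp GL X Z)"
    using le Leq_Cmp[of w x y z]
    by (simp add: fits_def Leq_GL Dom_GL Cod_GL sub_eq_iff Dom_in Cod_in Cmp_GL Cmp_in)
qed

section \<open>The double functor \<kappa> and its two weak equivalence conditions\<close>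

lemma kappa_simps [simp]:
  "Fun0 (kappa G) = poset_fnct (kappa_obj G)" "Fun1 (kappa G) = poset_fnct (kappa_arr G)"
  by (simp_all add: kappa_def)

lemma Leq_kappa_arr:
  assumes "X \<in> Arr GL" "Y \<in> Arr GL" "Leq GL X Y"
  shows "Leq G (kappa_arr G X) (kappa_arr G Y)"
  using assms by (elim GL_ArrE) (simp add: fits_def Leq_GL kappa_arr_spn)

lemma ObjLeq_kappa_obj:
  assumes "X \<in> Obj GL" "Y \<in> Obj GL" "ObjLeq GL X Y"
  shows "ObjLeq G (kappa_obj G X) (kappa_obj G Y)"
  using assms by (elim GL_ObjE) (simp add: ObjLeq_GL kappa_obj_sub)

lemma kappa_obj_in: "X \<in> Obj GL \<Longrightarrow> kappa_obj G X \<in> Obj G"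
  by (elim GL_ObjE) (simp add: kappa_obj_sub)

lemma kappa_Ide: "X \<in> Obj GL \<Longrightarrow> kappa_arr G (Ide GL X) = Ide G (kappa_obj G X)"
  by (elim GL_ObjE) (simp add: kappa_obj_sub Ide_GL kappa_arr_spn Ide_in)

lemma
  assumes "X \<in> Arr GL"
  shows kappa_arr_in: "kappa_arr G X \<in> Arr G"
    and kappa_Dom: "Dom G (kappa_arr G X) = kappa_obj G (Dom GL X)"
    and kappa_Cod: "Cod G (kappa_arr G X) = kappa_obj G (Cod GL X)"
  using assms
  by (elim GL_ArrE; simp add: fits_def kappa_obj_sub kappa_arr_spn Dom_GL Cod_GL Dom_in Cod_in)+

lemma kappa_Cmp:
  assumes "X \<in> Arr GL" "Y \<in> Arr GL" "Dom GL Y = Cod GL X"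
  shows "kappa_arr G (Cmp GL Y X) = Cmp G (kappa_arr G Y) (kappa_arr G X)"
  using assms
  by (elim GL_ArrE)
    (simp add: fits_def kappa_arr_spn Dom_GL Cod_GL sub_eq_iff Dom_in Cod_in Cmp_GL Cmp_in)

lemma functor_kappa_obj:
  "is_functor (poset_cat (Obj GL) (ObjLeq GL)) (poset_cat (Obj G) (ObjLeq G)) (poset_fnct (kappa_obj G))"
  using GL.category_objects category_objects kappa_obj_in ObjLeq_kappa_obj by (rule functor_poset_fnct)

lemma functor_kappa_arr:
  "is_functor (poset_cat (Arr GL) (Leq GL)) (poset_cat (Arr G) (Leq G)) (poset_fnct (kappa_arr G))"
  using GL.category_arrows category_arrows kappa_arr_in Leq_kappa_arr by (rule functor_poset_fnct)

lemma is_double_functor_kappa: "is_double_functor (double_of GL) (double_of G) (kappa G)"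
  unfolding is_double_functor_def
  using functor_kappa_obj functor_kappa_arr is_double_category_double_of GL.is_double_category_double_of
  by (auto intro!: feqI simp: composables_def kappa_Dom kappa_Cod kappa_Ide kappa_Cmp)

text \<open>A chain \<open>A \<le> B \<le> C \<le> D\<close> is lifted to the objects \<open>(A, D)\<close>, \<open>(B, D)\<close>, \<open>(C, D)\<close>,
  \<open>(D, D)\<close>, each paired with an identity arrow.\<close>

lemma ess_surjective_kappa: "ess_surjective TYPE('u) (double_of GL) (double_of G) (kappa G)"
proof -
  let ?O = "poset_cat (Obj G) (ObjLeq G)" and ?E = "pb (poset_cat (Obj GL) (ObjLeq GL))
    (poset_fnct (kappa_obj G)) (poset_fnct (Dom G)) (poset_cat (Arr G) (Leq G))"
  interpret triple_lifting ?E ?O "poset_fnct (Cod G) \<cdot> pr2"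
  proof
    show "is_functor ?E ?O (poset_fnct (Cod G) \<cdot> pr2)"
      by (rule functor_comp[OF functor_pb_pr2[OF functor_kappa_obj functor_Src] functor_Tgt])
  next
    fix u v w assume "u \<in> Arr ?O" "v \<in> Arr ?O" "w \<in> Arr ?O" "Dom ?O v = Cod ?O u" "Dom ?O w = Cod ?O v"
    then obtain A B C D where uvw: "u = (A, B)" "v = (B, C)" "w = (C, D)"
        and Obj: "A \<in> Obj G" "B \<in> Obj G" "C \<in> Obj G" "D \<in> Obj G"
        and le: "ObjLeq G A B" "ObjLeq G B C" "ObjLeq G C D"
      by (cases u; cases v; cases w) auto
    have leD: "ObjLeq G B D" "ObjLeq G A D" using Obj le ObjLeq_trans by metis+
    let ?l = "\<lambda>A B. ((sub A D, sub B D), (Ide G A, Ide G B))"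
    have "?l A B \<in> Arr ?E" "?l B C \<in> Arr ?E" "?l C D \<in> Arr ?E"
      using Obj le leD
      by (simp_all add: sub_in ObjLeq_refl ObjLeq_GL kappa_obj_sub Ide_in Dom_Ide ObjLeq_def[symmetric])
    then show "\<exists>u' v' w'. u' \<in> Arr ?E \<and> v' \<in> Arr ?E \<and> w' \<in> Arr ?E \<and> Dom ?E v' = Cod ?E u' \<and>
        Dom ?E w' = Cod ?E v' \<and> AMap (poset_fnct (Cod G) \<cdot> pr2) u' = u \<and>
        AMap (poset_fnct (Cod G) \<cdot> pr2) v' = v \<and> AMap (poset_fnct (Cod G) \<cdot> pr2) w' = w"
      using uvw Obj by (intro exI[of _ "?l A B"] exI[of _ "?l B C"] exI[of _ "?l C D"]) (simp add: Cod_Ide)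
  qed
  show ?thesis unfolding ess_surjective_def by (simp add: effective_descent)
qed

text \<open>\<open>kappa_arr\<close> forgets only the two bounds, and these are recorded in the
  source and the target.\<close>

lemma GL_arr_eqI:
  assumes "X \<in> Arr GL" "Y \<in> Arr GL" "kappa_arr G X = kappa_arr G Y" "Dom GL X = Dom GL Y" "Cod GL X = Cod GL Y"
  shows "X = Y"
  using assms
  by (elim GL_ArrE) (simp add: fits_def kappa_arr_spn Dom_GL Cod_GL sub_eq_iff Dom_in Cod_in)

lemma GL_arr_exists:
  assumes "g \<in> Arr G" "X \<in> Obj GL" "Y \<in> Obj GL" "Dom G g = kappa_obj G X" "Cod G g = kappa_obj G Y"
  shows "\<exists>Z. Z \<in> Arr GL \<and> kappa_arr G Z = g \<and> Dom GL Z = X \<and> Cod GL Z = Y"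
proof -
  from assms(2) obtain A B where X: "X = sub A B" "A \<in> Obj G" "B \<in> Obj G" "ObjLeq G A B" by (rule GL_ObjE)
  from assms(3) obtain C D where Y: "Y = sub C D" "C \<in> Obj G" "D \<in> Obj G" "ObjLeq G C D" by (rule GL_ObjE)
  show ?thesis
    using X Y assms(1,4,5) by (intro exI[of _ "spn g B D"])
      (simp add: kappa_obj_sub kappa_arr_spn Dom_GL Cod_GL spn_in fits_def)
qed

text \<open>Comparability of sources and of targets forces equality of the bounds, which is all that
  \<open>Leq GL\<close> adds to the order of \<open>G\<close>. This is full faithfulness on double
  cells.\<close>

lemma Leq_GL_iff:
  assumes "X \<in> Arr GL" "Y \<in> Arr GL"
  shows "Leq GL X Y \<longleftrightarrow> Leq G (kappa_arr G X) (kappa_arr G Y) \<and>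
    ObjLeq GL (Dom GL X) (Dom GL Y) \<and> ObjLeq GL (Cod GL X) (Cod GL Y)"
  using assms
  by (elim GL_ArrE)
    (auto simp: fits_def Leq_GL kappa_arr_spn Dom_GL Cod_GL ObjLeq_GL Dom_in Cod_in Leq_Dom Leq_Cod)

lemma fully_faithful_kappa: "fully_faithful U (double_of GL) (double_of G) (kappa G)"
  unfolding fully_faithful_def double_of_simps kappa_simps
proof (rule is_pullbackI)
  let ?O = "poset_cat (Obj G) (ObjLeq G)" and ?O' = "poset_cat (Obj GL) (ObjLeq GL)"
  show "is_functor (prod_cat ?O' ?O') (prod_cat ?O ?O)
      (fpair (poset_fnct (kappa_obj G) \<cdot> pr1) (poset_fnct (kappa_obj G) \<cdot> pr2))"
    using functor_kappa_obj GL.category_objects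
    by (intro functor_fpair_prod functor_comp[where B = ?O'] functor_prod_pr1 functor_prod_pr2)
next
  fix g S assume "g \<in> Obj (poset_cat (Arr G) (Leq G))"
    "S \<in> Obj (prod_cat (poset_cat (Obj GL) (ObjLeq GL)) (poset_cat (Obj GL) (ObjLeq GL)))"
    "OMap (fpair (poset_fnct (Dom G)) (poset_fnct (Cod G))) g =
      OMap (fpair (poset_fnct (kappa_obj G) \<cdot> pr1) (poset_fnct (kappa_obj G) \<cdot> pr2)) S"
  then obtain Z where Z: "Z \<in> Arr GL" "kappa_arr G Z = g" "Dom GL Z = fst S" "Cod GL Z = snd S"
    using GL_arr_exists[of g "fst S" "snd S"] by auto
  show "\<exists>!Z. Z \<in> Obj (poset_cat (Arr GL) (Leq GL)) \<and> OMap (poset_fnct (kappa_arr G)) Z = g \<and>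
      OMap (fpair (poset_fnct (Dom GL)) (poset_fnct (Cod GL))) Z = S"
  proof (rule ex1I)
    fix W assume "W \<in> Obj (poset_cat (Arr GL) (Leq GL)) \<and> OMap (poset_fnct (kappa_arr G)) W = g \<and>
      OMap (fpair (poset_fnct (Dom GL)) (poset_fnct (Cod GL))) W = S"
    then show "W = Z" using Z by (intro GL_arr_eqI) auto
  qed (simp add: Z)
next
  fix u S assume u: "u \<in> Arr (poset_cat (Arr G) (Leq G))"
    and S: "S \<in> Arr (prod_cat (poset_cat (Obj GL) (ObjLeq GL)) (poset_cat (Obj GL) (ObjLeq GL)))"
    and eq: "AMap (fpair (poset_fnct (Dom G)) (poset_fnct (Cod G))) u =
      AMap (fpair (poset_fnct (kappa_obj G) \<cdot> pr1) (poset_fnct (kappa_obj G) \<cdot> pr2)) S"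
  \<comment> \<open>The inner pairs are the order relations: \<open>X\<close> below
    \<open>X'\<close> for the sources and \<open>Y\<close> below \<open>Y'\<close> for the
    targets.\<close>
  obtain g g' X X' Y Y' where [simp]: "u = (g, g')" "S = ((X, X'), (Y, Y'))" by (metis surj_pair)
  obtain Z where Z: "Z \<in> Arr GL" "kappa_arr G Z = g" "Dom GL Z = X" "Cod GL Z = Y"
    using GL_arr_exists[of g X Y] u S eq by auto
  obtain Z' where Z': "Z' \<in> Arr GL" "kappa_arr G Z' = g'" "Dom GL Z' = X'" "Cod GL Z' = Y'"
    using GL_arr_exists[of g' X' Y'] u S eq by auto
  \<comment> \<open>The lower and upper ends are lifted separately; that they form a double cell is
    then a property, not a further choice.\<close>
  have "Leq GL Z Z'" using Leq_GL_iff Z Z' u S by simp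
  show "\<exists>!W. W \<in> Arr (poset_cat (Arr GL) (Leq GL)) \<and> AMap (poset_fnct (kappa_arr G)) W = u \<and>
      AMap (fpair (poset_fnct (Dom GL)) (poset_fnct (Cod GL))) W = S"
  proof (rule ex1I)
    fix W assume W: "W \<in> Arr (poset_cat (Arr GL) (Leq GL)) \<and> AMap (poset_fnct (kappa_arr G)) W = u \<and>
      AMap (fpair (poset_fnct (Dom GL)) (poset_fnct (Cod GL))) W = S"
    have "fst W = Z" using W Z by (intro GL_arr_eqI) auto
    moreover have "snd W = Z'" using W Z' by (intro GL_arr_eqI) auto
    ultimately show "W = (Z, Z')" by (simp add: prod_eq_iff)
  qed (use Z Z' \<open>Leq GL Z Z'\<close> in simp)
qed (auto intro!: feqI functor_kappa_arr functor_fpair_prod functor_Src functor_Tgt GL.functor_Src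
    GL.functor_Tgt simp: kappa_Dom kappa_Cod)

end

theorem proposition3p2:
  fixes G :: "('o, 'a) ogpd"
  assumes "ordered_groupoid G"
  shows "weak_equivalence TYPE('u) (double_of (G_ogpd (L_cat G))) (double_of G) (kappa G)"
proof -
  interpret ordered_groupoid G by fact
  show ?thesis
    unfolding weak_equivalence_def
    using is_double_functor_kappa ess_surjective_kappa fully_faithful_kappa by blast
qed

end
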